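(* Let $M$ and $N$ be matroids on a common ground set such that $N$ is an elementary lift or an elementary projection of $M$ (and $N \neq M$, i.e. $\mathrm{dist}(M,N)=1$). Then: (i) if $s \ge 2$ and $M$ has a $U_{s2^{4s},\,2s2^{4s}}$-minor, then $N$ has a $U_{s,2s}$-minor; (ii) if $n \ge 3$, $q$ is a prime power, and $M$ has a $\mathrm{PG}(n-1,q)$-minor, then $N$ has a $\mathrm{PG}(n-3,q)$-minor.
   Context: An elementary projection of $M$ is a matroid obtained from an extension of $M$ by contracting the new element; an elementary lift of $M$ is one obtained from a coextension of $M$ by deleting the new element. For matroids $M,N$ on a common ground set, $\mathrm{dist}(M,N)$ is the minimum $d \ge 0$ such that there is a sequence $M = M_0, M_1, \dots, M_d = N$ in which each $M_i$ is an elementary lift or elementary projection of $M_{i-1}$. *)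

theory Defs
  imports Main "HOL-Library.Extended_Nat" "HOL-Library.Function_Algebras"
    "HOL-Number_Theory.Prime_Powers"
begin

record 'a matroid =
  ground :: "'a set"
  indep :: "'a set set"

definition is_matroid :: "'a matroid \<Rightarrow> bool" where
  "is_matroid M \<longleftrightarrow>
     finite (ground M) \<and>
     indep M \<subseteq> Pow (ground M) \<and>
     {} \<in> indep M \<and>
     (\<forall>I\<in>indep M. \<forall>J. J \<subseteq> I \<longrightarrow> J \<in> indep M) \<and>
     (\<forall>I\<in>indep M. \<forall>J\<in>indep M. card I < card J \<longrightarrow> (\<exists>x\<in>J - I. insert x I \<in> indep M))"

definition matroid_rank :: "'a matroid \<Rightarrow> 'a set \<Rightarrow> nat" where
  "matroid_rank M X = Max (card ` {I \<in> indep M. I \<subseteq> X})"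

definition delete :: "'a matroid \<Rightarrow> 'a set \<Rightarrow> 'a matroid" where
  "delete M D = \<lparr>ground = ground M - D, indep = {I \<in> indep M. I \<inter> D = {}}\<rparr>"

text \<open>The matroid with rank function \<open>I \<mapsto> r (I \<union> C) - r C\<close>.\<close>

definition contract :: "'a matroid \<Rightarrow> 'a set \<Rightarrow> 'a matroid" where
  "contract M C =
     \<lparr>ground = ground M - C,
      indep = {I. I \<subseteq> ground M - C \<and>
                  matroid_rank M (I \<union> C) = card I + matroid_rank M C}\<rparr>"

definition is_minor :: "'a matroid \<Rightarrow> 'a matroid \<Rightarrow> bool" where
  "is_minor N M \<longleftrightarrow>
     (\<exists>C D. C \<subseteq> ground M \<and> D \<subseteq> ground M \<and> C \<inter> D = {} \<and> N = delete (contract M C) D)"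

definition matroid_iso :: "'a matroid \<Rightarrow> 'b matroid \<Rightarrow> bool" where
  "matroid_iso M N \<longleftrightarrow>
     (\<exists>f. bij_betw f (ground M) (ground N) \<and>
          (\<forall>I. I \<subseteq> ground M \<longrightarrow> (I \<in> indep M \<longleftrightarrow> f ` I \<in> indep N)))"

definition has_minor :: "'a matroid \<Rightarrow> 'b matroid \<Rightarrow> bool" where
  "has_minor M N \<longleftrightarrow> (\<exists>N'. is_minor N' M \<and> matroid_iso N' N)"

definition map_matroid :: "('a \<Rightarrow> 'b) \<Rightarrow> 'a matroid \<Rightarrow> 'b matroid" where
  "map_matroid f M = \<lparr>ground = f ` ground M, indep = (\<lambda>I. f ` I) ` indep M\<rparr>"

text \<open>Extensions and coextensions live on the type \<open>'a option\<close>, with \<open>None\<close> as the new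
  element: the type \<open>'a\<close> itself may have no element outside the ground set.\<close>

definition extension :: "'a matroid \<Rightarrow> 'a option matroid \<Rightarrow> bool" where
  "extension M K \<longleftrightarrow>
     is_matroid K \<and> None \<in> ground K \<and> delete K {None} = map_matroid Some M"

definition coextension :: "'a matroid \<Rightarrow> 'a option matroid \<Rightarrow> bool" where
  "coextension M K \<longleftrightarrow>
     is_matroid K \<and> None \<in> ground K \<and> contract K {None} = map_matroid Some M"

text \<open>The second argument is the projection, respectively the lift, of the first.\<close>

definition elementary_projection :: "'a matroid \<Rightarrow> 'a matroid \<Rightarrow> bool" where
  "elementary_projection M N \<longleftrightarrow>
     (\<exists>K. extension M K \<and> contract K {None} = map_matroid Some N)"

definition elementary_lift :: "'a matroid \<Rightarrow> 'a matroid \<Rightarrow> bool" where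
  "elementary_lift M N \<longleftrightarrow>
     (\<exists>K. coextension M K \<and> delete K {None} = map_matroid Some N)"

definition matroid_dist :: "'a matroid \<Rightarrow> 'a matroid \<Rightarrow> enat" where
  "matroid_dist M N =
     Inf {enat d | d. \<exists>f. f 0 = M \<and> f d = N \<and>
       (\<forall>i<d. elementary_lift (f i) (f (Suc i)) \<or> elementary_projection (f i) (f (Suc i)))}"

lemma matroid_dist_eq_1_iff:
  "matroid_dist M N = 1 \<longleftrightarrow>
     (elementary_lift M N \<or> elementary_projection M N) \<and> N \<noteq> M"
proof -
  define P where "P d \<longleftrightarrow> (\<exists>f. f 0 = M \<and> f d = N \<and>
       (\<forall>i<d. elementary_lift (f i) (f (Suc i)) \<or> elementary_projection (f i) (f (Suc i))))"
    for d :: nat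
  have dist: "matroid_dist M N = Inf {enat d | d. P d}"
    by (simp add: matroid_dist_def P_def)
  have P0: "P 0 \<longleftrightarrow> N = M"
    by (auto simp: P_def)
  have P1: "P 1 \<longleftrightarrow> elementary_lift M N \<or> elementary_projection M N"
  proof
    assume "elementary_lift M N \<or> elementary_projection M N"
    then show "P 1"
      unfolding P_def by (intro exI[of _ "\<lambda>i. if i = 0 then M else N"]) auto
  qed (auto simp: P_def)
  have "Inf {enat d | d. P d} = 1 \<longleftrightarrow> P 1 \<and> \<not> P 0"
  proof
    assume eq: "Inf {enat d | d. P d} = 1"
    then have ne: "{enat d | d. P d} \<noteq> {}"
      by (metis Inf_empty infinity_ne_i1 top_enat_def)
    have "Inf {enat d | d. P d} \<in> {enat d | d. P d}"
      using ne by (meson ex_in_conv wellorder_InfI)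
    with eq have "P 1" by (auto simp: one_enat_def)
    moreover have "\<not> P 0"
    proof
      assume "P 0"
      then have "Inf {enat d | d. P d} \<le> enat 0" by (intro Inf_lower) blast
      with eq show False by (simp add: one_enat_def)
    qed
    ultimately show "P 1 \<and> \<not> P 0" by simp
  next
    assume P: "P 1 \<and> \<not> P 0"
    show "Inf {enat d | d. P d} = 1"
    proof (rule antisym)
      show "Inf {enat d | d. P d} \<le> 1"
        unfolding one_enat_def using P by (intro Inf_lower) blast
      show "1 \<le> Inf {enat d | d. P d}"
      proof (rule Inf_greatest)
        fix x assume "x \<in> {enat d | d. P d}"
        then obtain d where "x = enat d" "P d" by blast
        moreover from P \<open>P d\<close> have "d \<noteq> 0" by (metis)
        ultimately show "1 \<le> x" by (simp add: one_enat_def)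
      qed
    qed
  qed
  then show ?thesis
    unfolding dist P0 P1 .
qed

definition uniform :: "nat \<Rightarrow> nat \<Rightarrow> nat matroid" where
  "uniform r n = \<lparr>ground = {..<n}, indep = {I. I \<subseteq> {..<n} \<and> card I \<le> r}\<rparr>"

definition coord_scale :: "'f::field \<Rightarrow> (nat \<Rightarrow> 'f) \<Rightarrow> nat \<Rightarrow> 'f" where
  "coord_scale c v = (\<lambda>i. c * v i)"

global_interpretation coord: vector_space coord_scale
  by unfold_locales (auto simp: coord_scale_def fun_eq_iff algebra_simps)

text \<open>\<open>PG d\<close> is the projective geometry of projective dimension \<open>d\<close>: its points are the
  one-dimensional subspaces of the space \<open>'f\<^sup>d\<^sup>+\<^sup>1\<close>, rendered as the functions on \<open>nat\<close>
  that vanish beyond \<open>d\<close>.\<close>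

definition PG_points :: "nat \<Rightarrow> (nat \<Rightarrow> 'f::field) set set" where
  "PG_points d = {L. coord.subspace L \<and> L \<subseteq> {v. \<forall>i>d. v i = 0} \<and> coord.dim L = 1}"

definition PG :: "nat \<Rightarrow> (nat \<Rightarrow> 'f::field) set matroid" where
  "PG d = \<lparr>ground = PG_points d,
           indep = {X. X \<subseteq> PG_points d \<and> coord.dim (\<Union>X) = card X}\<rparr>"

end

theory Submission imports Defs begin

text \<open>For an extension \<open>K\<close> by \<open>e\<close>, the difference \<open>\<delta> = q - p\<close> of the rank functions \<open>q\<close> of
  \<open>K \ e\<close> and \<open>p\<close> of \<open>K / e\<close> is monotone with values in \<open>{0, 1}\<close>, and this is all that is used.
  The case of a projection has \<open>q\<close> uniform or projective, the case of a lift has \<open>p\<close> so; minors of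
  \<open>M\<close> and \<open>N\<close> on the same sets are again related in this way.

  Uniform, projection: after a contraction \<open>q\<close> has rank \<open>2 s\<close>, and a greedy choice finds \<open>3 s - 1\<close>
  elements on which \<open>\<delta>\<close> vanishes for all sets of at most \<open>2 s - 1\<close> elements; contracting \<open>s - 1\<close> of
  them leaves \<open>U\<^bsub>s,2s\<^esub>\<close> in \<open>p\<close>. The lift is dual. Projective, projection: some flat of corank at
  most one has \<open>\<delta> = 0\<close>, so its restriction survives. Projective, lift: if all collinear triples have
  \<open>\<delta> = 0\<close>, then a basis of \<open>p\<close> spans \<open>q\<close> and \<open>\<delta> = 0\<close>; otherwise contracting a triple
  with \<open>\<delta> = 1\<close> makes the two matroids equal, and a flat skew to it is the required geometry.\<close>

section \<open>Rank functions\<close>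

text \<open>Ranks are integers, so that the differences which describe contractions never
  truncate.\<close>

locale rank_function =
  fixes E :: "'a set" and r :: "'a set \<Rightarrow> int"
  assumes finite_ground: "finite E"
    and rank_nonneg: "X \<subseteq> E \<Longrightarrow> 0 \<le> r X"
    and rank_le_card: "X \<subseteq> E \<Longrightarrow> r X \<le> int (card X)"
    and rank_mono: "X \<subseteq> Y \<Longrightarrow> Y \<subseteq> E \<Longrightarrow> r X \<le> r Y"
    and rank_submodular: "X \<subseteq> E \<Longrightarrow> Y \<subseteq> E \<Longrightarrow> r (X \<union> Y) + r (X \<inter> Y) \<le> r X + r Y"
begin

lemma finite_subset_ground: "X \<subseteq> E \<Longrightarrow> finite X"
  using finite_ground finite_subset by blast

lemma rank_empty: "r {} = 0"
  using rank_nonneg[of "{}"] rank_le_card[of "{}"] by simp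

text \<open>Submodularity for \<open>X \<union> Z\<close> and \<open>Y\<close>, whose union is
  \<open>Y \<union> Z\<close> and whose intersection contains \<open>X\<close>.\<close>

lemma rank_diminishing:
  assumes "X \<subseteq> Y" "Y \<subseteq> E" "Z \<subseteq> E"
  shows "r (Y \<union> Z) - r Y \<le> r (X \<union> Z) - r X"
proof -
  have "r ((X \<union> Z) \<union> Y) + r ((X \<union> Z) \<inter> Y) \<le> r (X \<union> Z) + r Y"
    using assms by (intro rank_submodular) auto
  moreover have "r X \<le> r ((X \<union> Z) \<inter> Y)"
    using assms by (intro rank_mono) auto
  moreover have "(X \<union> Z) \<union> Y = Y \<union> Z"
    using assms by auto
  ultimately show ?thesis by simp
qed

lemma rank_union_le:
  assumes "X \<subseteq> E" "Y \<subseteq> E"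
  shows "r (X \<union> Y) \<le> r X + r Y"
  using rank_diminishing[of "{}" X Y] assms rank_empty by simp

lemma rank_insert_le:
  assumes "X \<subseteq> E" "x \<in> E"
  shows "r (insert x X) \<le> r X + 1"
  using rank_union_le[of X "{x}"] rank_le_card[of "{x}"] assms by simp

text \<open>When the elements of \<open>Y\<close> are added one by one, each gain is at most the
  gain over \<open>X\<close> alone, which is zero.\<close>

lemma rank_closure:
  assumes "X \<subseteq> E" "Y \<subseteq> E" "\<And>y. y \<in> Y \<Longrightarrow> r (insert y X) = r X"
  shows "r (X \<union> Y) = r X"
proof -
  have "finite Y" using assms(2) by (rule finite_subset_ground)
  then show ?thesis
    using assms(2,3)
  proof (induction Y)
    case (insert y Y)
    have "r ((X \<union> Y) \<union> {y}) - r (X \<union> Y) \<le> r (X \<union> {y}) - r X"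
      using insert.prems assms(1) by (intro rank_diminishing) auto
    moreover have "r (X \<union> Y) = r X"
      using insert by auto
    moreover have "r X \<le> r (X \<union> insert y Y)"
      using insert.prems assms(1) by (intro rank_mono) auto
    ultimately show ?case
      using insert.prems(2)[of y] by simp
  qed simp
qed

text \<open>A rank deficit in \<open>J\<close> would persist in \<open>I\<close>, since
  \<open>I - J\<close> contributes at most its cardinality.\<close>

lemma independent_subset:
  assumes "r I = int (card I)" "J \<subseteq> I" "I \<subseteq> E"
  shows "r J = int (card J)"
proof -
  have "r (J \<union> (I - J)) \<le> r J + r (I - J)"
    using assms by (intro rank_union_le) auto
  moreover have "r (I - J) \<le> int (card (I - J))"
    using assms by (intro rank_le_card) auto
  moreover have "card (I - J) + card J = card I"
    using assms finite_subset_ground[of I]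
    by (metis card_Diff_subset card_mono finite_subset le_add_diff_inverse2)
  moreover have "J \<union> (I - J) = I" using assms by auto
  moreover have "r J \<le> int (card J)"
    using assms by (intro rank_le_card) auto
  ultimately show ?thesis using assms(1) by simp
qed

text \<open>If no element of \<open>X\<close> raised the rank of \<open>J\<close>, then
  \<open>J\<close> would have the rank of \<open>X\<close> by \<open>rank_closure\<close>. So as
  long as \<open>J\<close> is too small, some element raises its rank, and by exactly one.\<close>

lemma independent_augment:
  assumes "I \<subseteq> X" "X \<subseteq> E" "r I = int (card I)" "card I \<le> k" "int k \<le> r X"
  shows "\<exists>J. I \<subseteq> J \<and> J \<subseteq> X \<and> r J = int (card J) \<and> card J = k"
  using assms(4,5)
proof (induction k rule: dec_induct)
  case base
  then show ?case using assms by blast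
next
  case (step k)
  then obtain J where J: "I \<subseteq> J" "J \<subseteq> X" "r J = int (card J)" "card J = k"
    by force
  obtain x where x: "x \<in> X" "r (insert x J) \<noteq> r J"
  proof (rule ccontr)
    assume "\<not> thesis"
    then have "r (J \<union> X) = r J"
      using that J assms(2) by (intro rank_closure) auto
    moreover have "J \<union> X = X" using J by auto
    ultimately show False using J step.prems by simp
  qed
  then have xJ: "x \<notin> J" by (auto simp: insert_absorb)
  have "r (insert x J) \<le> r J + 1" "r J \<le> r (insert x J)"
    using x(1) J(2) assms(2) by (blast intro: rank_insert_le rank_mono)+
  moreover have "finite J" using J assms(2) finite_subset_ground by blast
  ultimately have "r (insert x J) = int (card (insert x J))" "card (insert x J) = Suc k"
    using x J xJ by auto
  then show ?case using J x by (intro exI[of _ "insert x J"]) auto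
qed

lemma basis_exists:
  assumes "X \<subseteq> E"
  shows "\<exists>J\<subseteq>X. r J = int (card J) \<and> r J = r X"
  using independent_augment[of "{}" X "nat (r X)"] assms rank_nonneg[of X] rank_empty by auto

text \<open>This is the rank function of the contraction of \<open>C\<close>, restricted to the
  image of \<open>T\<close> and pulled back along \<open>g\<close>. The pullback places a minor on
  the ground set of the matroid it is isomorphic to.\<close>

lemma minor_rank_function:
  assumes "C \<subseteq> E" "finite T" "inj_on g T" "g ` T \<subseteq> E"
  shows "rank_function T (\<lambda>X. r (g ` X \<union> C) - r C)"
proof
  show "finite T" by fact
next
  fix X assume X: "X \<subseteq> T"
  then have gX: "g ` X \<subseteq> E" using assms by auto
  show "0 \<le> r (g ` X \<union> C) - r C"
    using rank_mono[of C "g ` X \<union> C"] gX assms by simp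
  have "card (g ` X) = card X" using X assms by (meson card_image inj_on_subset)
  then show "r (g ` X \<union> C) - r C \<le> int (card X)"
    using rank_union_le[of "g ` X" C] rank_le_card[of "g ` X"] gX assms by simp
next
  fix X Y assume "X \<subseteq> Y" "Y \<subseteq> T"
  then show "r (g ` X \<union> C) - r C \<le> r (g ` Y \<union> C) - r C"
    using assms by (intro diff_right_mono rank_mono) blast+
next
  fix X Y assume XY: "X \<subseteq> T" "Y \<subseteq> T"
  have "r ((g ` X \<union> C) \<union> (g ` Y \<union> C)) + r ((g ` X \<union> C) \<inter> (g ` Y \<union> C))
      \<le> r (g ` X \<union> C) + r (g ` Y \<union> C)"
    using XY assms by (intro rank_submodular) blast+
  moreover have "(g ` X \<union> C) \<union> (g ` Y \<union> C) = g ` (X \<union> Y) \<union> C" by auto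
  moreover have "(g ` X \<union> C) \<inter> (g ` Y \<union> C) = g ` (X \<inter> Y) \<union> C"
    using XY assms by (auto simp: inj_on_image_Int)
  ultimately show "r (g ` (X \<union> Y) \<union> C) - r C + (r (g ` (X \<inter> Y) \<union> C) - r C)
      \<le> r (g ` X \<union> C) - r C + (r (g ` Y \<union> C) - r C)"
    by simp
qed

end

section \<open>Quotients of corank at most one\<close>

locale rank_quotient = p: rank_function E p + q: rank_function E q
  for E :: "'a set" and p q +
  assumes quotient: "X \<subseteq> Y \<Longrightarrow> Y \<subseteq> E \<Longrightarrow> p Y - p X \<le> q Y - q X"
    and corank: "q E \<le> p E + 1"
begin

lemma quotient_le: "X \<subseteq> E \<Longrightarrow> p X \<le> q X"
  using quotient[of "{}" X] p.rank_empty q.rank_empty by simp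

lemma quotient_ge: "X \<subseteq> E \<Longrightarrow> q X \<le> p X + 1"
  using quotient[of X E] corank by simp

lemma quotient_eq_subset: "Y \<subseteq> E \<Longrightarrow> q Y = p Y \<Longrightarrow> X \<subseteq> Y \<Longrightarrow> q X = p X"
  using quotient[of X Y] quotient_le[of X] by force

text \<open>The new difference is \<delta> of the set joined with \<open>C\<close>, minus \<delta>
  of \<open>C\<close>. It is again monotone, and at most one because \<delta> takes values in {0,
  1}.\<close>

lemma minor_rank_quotient:
  assumes "C \<subseteq> E" "finite T" "inj_on g T" "g ` T \<subseteq> E"
  shows "rank_quotient T (\<lambda>X. p (g ` X \<union> C) - p C) (\<lambda>X. q (g ` X \<union> C) - q C)"
proof -
  interpret p': rank_function T "\<lambda>X. p (g ` X \<union> C) - p C"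
    using assms by (rule p.minor_rank_function)
  interpret q': rank_function T "\<lambda>X. q (g ` X \<union> C) - q C"
    using assms by (rule q.minor_rank_function)
  show ?thesis
  proof
    fix X Y assume "X \<subseteq> Y" "Y \<subseteq> T"
    then have "p (g ` Y \<union> C) - p (g ` X \<union> C) \<le> q (g ` Y \<union> C) - q (g ` X \<union> C)"
      using assms by (intro quotient) blast+
    then show "p (g ` Y \<union> C) - p C - (p (g ` X \<union> C) - p C)
        \<le> q (g ` Y \<union> C) - q C - (q (g ` X \<union> C) - q C)" by simp
  next
    show "q (g ` T \<union> C) - q C \<le> p (g ` T \<union> C) - p C + 1"
      using quotient_le[of C] quotient_ge[of "g ` T \<union> C"] assms by simp
  qed
qed

end

section \<open>Matroids and their rank functions\<close>

lemma finite_indep: "is_matroid M \<Longrightarrow> finite (indep M)"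
  unfolding is_matroid_def using finite_subset[of "indep M" "Pow (ground M)"] by simp

lemma indep_card_le_rank:
  assumes "is_matroid M" "I \<in> indep M" "I \<subseteq> X"
  shows "card I \<le> matroid_rank M X"
  unfolding matroid_rank_def using assms finite_indep[of M] by (intro Max_ge) auto

lemma matroid_rank_attained:
  assumes "is_matroid M"
  shows "\<exists>I\<in>indep M. I \<subseteq> X \<and> card I = matroid_rank M X"
proof -
  have "finite (indep M)" "{} \<in> indep M"
    using assms finite_indep[of M] by (auto simp: is_matroid_def)
  then have "matroid_rank M X \<in> card ` {I \<in> indep M. I \<subseteq> X}"
    unfolding matroid_rank_def by (intro Max_in) auto
  then show ?thesis by auto
qed

lemma matroid_indep_finite: "is_matroid M \<Longrightarrow> I \<in> indep M \<Longrightarrow> finite I"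
  unfolding is_matroid_def using finite_subset[of I "ground M"] by auto

text \<open>As long as \<open>I\<close> is smaller than a maximum independent subset of
  \<open>X\<close>, the exchange axiom adds an element of that subset; the induction runs over the
  number of missing elements.\<close>

lemma matroid_indep_extend:
  assumes M: "is_matroid M" and "I \<in> indep M" "I \<subseteq> X"
  shows "\<exists>J\<in>indep M. I \<subseteq> J \<and> J \<subseteq> X \<and> card J = matroid_rank M X"
  using assms(2,3)
proof (induction "matroid_rank M X - card I" arbitrary: I)
  case 0
  then show ?case
    using indep_card_le_rank[OF M] by (intro bexI[of _ I]) (auto intro: antisym)
next
  case (Suc m)
  obtain B where B: "B \<in> indep M" "B \<subseteq> X" "card B = matroid_rank M X"
    using matroid_rank_attained[OF M] by blast
  have "card I < card B" using Suc.hyps(2) B by simp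
  then obtain x where x: "x \<in> B - I" "insert x I \<in> indep M"
    using M Suc.prems(1) B(1) unfolding is_matroid_def by blast
  have "finite I" using M Suc.prems(1) by (rule matroid_indep_finite)
  then have "m = matroid_rank M X - card (insert x I)"
    using Suc.hyps(2) x by simp
  then have "\<exists>J\<in>indep M. insert x I \<subseteq> J \<and> J \<subseteq> X \<and> card J = matroid_rank M X"
    using x B Suc.prems by (intro Suc.hyps(1)) auto
  then show ?case by blast
qed

lemma matroid_rank_function:
  assumes M: "is_matroid M"
  shows "rank_function (ground M) (\<lambda>X. int (matroid_rank M X))"
proof
  show "finite (ground M)" using M by (simp add: is_matroid_def)
next
  fix X assume X: "X \<subseteq> ground M"
  then have "finite X" using M finite_subset[of X] by (simp add: is_matroid_def)
  moreover obtain I where "I \<subseteq> X" "card I = matroid_rank M X"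
    using matroid_rank_attained[OF M] by blast
  ultimately show "int (matroid_rank M X) \<le> int (card X)"
    by (metis card_mono of_nat_mono)
next
  fix X Y :: "'a set" assume "X \<subseteq> Y"
  moreover obtain I where "I \<in> indep M" "I \<subseteq> X" "card I = matroid_rank M X"
    using matroid_rank_attained[OF M] by blast
  ultimately show "int (matroid_rank M X) \<le> int (matroid_rank M Y)"
    using indep_card_le_rank[OF M, of I Y] by auto
next
  fix X Y :: "'a set"
  obtain I where I: "I \<in> indep M" "I \<subseteq> X \<inter> Y" "card I = matroid_rank M (X \<inter> Y)"
    using matroid_rank_attained[OF M] by blast
  \<comment> \<open>A basis of the intersection is extended to one of the union. Its traces on
    \<open>X\<close> and \<open>Y\<close> are independent, and together they count every element of
    \<open>J\<close> once and those of \<open>I\<close> twice.\<close>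
  then obtain J where J: "J \<in> indep M" "I \<subseteq> J" "J \<subseteq> X \<union> Y" "card J = matroid_rank M (X \<union> Y)"
    using matroid_indep_extend[OF M, of I "X \<union> Y"] by blast
  have fin: "finite J" using M J(1) by (rule matroid_indep_finite)
  have sub: "K \<in> indep M" if "K \<subseteq> J" for K
    using that J(1) M unfolding is_matroid_def by blast
  have "card (J \<inter> X) \<le> matroid_rank M X" "card (J \<inter> Y) \<le> matroid_rank M Y"
    by (auto intro!: indep_card_le_rank[OF M] sub)
  moreover have "J \<inter> X \<union> J \<inter> Y = J" using J by auto
  then have "card (J \<inter> X) + card (J \<inter> Y) = card J + card ((J \<inter> X) \<inter> (J \<inter> Y))"
    using fin card_Un_Int[of "J \<inter> X" "J \<inter> Y"] by simp
  moreover have "card I \<le> card ((J \<inter> X) \<inter> (J \<inter> Y))"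
    using I J fin by (intro card_mono) auto
  ultimately show "int (matroid_rank M (X \<union> Y)) + int (matroid_rank M (X \<inter> Y))
      \<le> int (matroid_rank M X) + int (matroid_rank M Y)"
    using I J by linarith
qed simp

lemma indep_iff_rank:
  assumes M: "is_matroid M"
  shows "I \<in> indep M \<longleftrightarrow> I \<subseteq> ground M \<and> matroid_rank M I = card I"
proof
  assume I: "I \<in> indep M"
  then have "I \<subseteq> ground M" using M by (auto simp: is_matroid_def)
  moreover have "int (matroid_rank M I) \<le> int (card I)"
    using \<open>I \<subseteq> ground M\<close> by (rule rank_function.rank_le_card[OF matroid_rank_function[OF M]])
  ultimately show "I \<subseteq> ground M \<and> matroid_rank M I = card I"
    using indep_card_le_rank[OF M I, of I] by simp
next
  assume I: "I \<subseteq> ground M \<and> matroid_rank M I = card I"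
  then obtain J where "J \<in> indep M" "J \<subseteq> I" "card J = card I"
    using matroid_rank_attained[OF M, of I] by auto
  moreover have "finite I" using I M finite_subset[of I "ground M"] by (simp add: is_matroid_def)
  ultimately show "I \<in> indep M" by (metis card_subset_eq)
qed

text \<open>Independent sets determine the rank: a basis of \<open>X\<close> attains the maximum,
  and monotonicity of \<open>r\<close> bounds every other candidate.\<close>

lemma (in rank_function) matroid_rank_eq:
  assumes N: "indep N = {I. I \<subseteq> E \<and> r I = int (card I)}" and X: "X \<subseteq> E"
  shows "int (matroid_rank N X) = r X"
proof -
  obtain J where J: "J \<subseteq> X" "r J = int (card J)" "r J = r X"
    using basis_exists[OF X] by blast
  have "matroid_rank N X = card J"
    unfolding matroid_rank_def
  proof (rule Max_eqI)
    have "finite X" using X by (rule finite_subset_ground)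
    then show "finite (card ` {I \<in> indep N. I \<subseteq> X})" by simp
    show "card J \<in> card ` {I \<in> indep N. I \<subseteq> X}"
      using J X N by auto
    fix k assume "k \<in> card ` {I \<in> indep N. I \<subseteq> X}"
    then obtain I where I: "I \<subseteq> E" "r I = int (card I)" "I \<subseteq> X" "k = card I"
      using N by auto
    then have "r I \<le> r X" using X by (intro rank_mono)
    then show "k \<le> card J" using I J by simp
  qed
  then show ?thesis using J by simp
qed

section \<open>Minors in terms of rank functions\<close>

definition rank_minor :: "'a set \<Rightarrow> ('a set \<Rightarrow> int) \<Rightarrow> 'b matroid \<Rightarrow> bool" where
  "rank_minor E r L \<longleftrightarrow>
     (\<exists>C g. C \<subseteq> E \<and> inj_on g (ground L) \<and> g ` ground L \<subseteq> E - C \<and>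
        (\<forall>I. I \<subseteq> ground L \<longrightarrow> (I \<in> indep L \<longleftrightarrow> r (g ` I \<union> C) - r C = int (card I))))"

text \<open>The embedding \<open>g\<close> is the inverse of the isomorphism from the minor to
  \<open>L\<close>. The deleted set is implicit in \<open>rank_minor\<close>: it consists of
  everything outside \<open>C\<close> and the image of \<open>g\<close>.\<close>

lemma has_minor_iff_rank_minor:
  assumes r: "\<And>X. X \<subseteq> ground M \<Longrightarrow> int (matroid_rank M X) = r X"
  shows "has_minor M L \<longleftrightarrow> rank_minor (ground M) r L"
proof
  assume "has_minor M L"
  then obtain C D f where CD: "C \<subseteq> ground M" "D \<subseteq> ground M" "C \<inter> D = {}"
    and f: "bij_betw f (ground (delete (contract M C) D)) (ground L)"
    and ind: "\<And>I. I \<subseteq> ground (delete (contract M C) D) \<Longrightarrow>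
      (I \<in> indep (delete (contract M C) D) \<longleftrightarrow> f ` I \<in> indep L)"
    unfolding has_minor_def is_minor_def matroid_iso_def by blast
  define T where "T = ground M - C - D"
  have T: "ground (delete (contract M C) D) = T"
    by (simp add: T_def delete_def contract_def)
  define g where "g = the_inv_into T f"
  have bij: "bij_betw g (ground L) T"
    using f unfolding g_def T by (rule bij_betw_the_inv_into)
  have fg: "f (g x) = x" if "x \<in> ground L" for x
    using f that unfolding g_def T by (meson bij_betw_def f_the_inv_into_f_bij_betw)
  show "rank_minor (ground M) r L"
    unfolding rank_minor_def
  proof (intro exI conjI allI impI)
    show "C \<subseteq> ground M" by fact
    show "inj_on g (ground L)" using bij by (rule bij_betw_imp_inj_on)
    show "g ` ground L \<subseteq> ground M - C" using bij by (auto simp: bij_betw_def T_def)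
    fix I assume I: "I \<subseteq> ground L"
    have gI: "g ` I \<subseteq> T" using I bij by (auto simp: bij_betw_def)
    have "f ` g ` I = I" using I fg by (force simp: image_iff)
    then have "I \<in> indep L \<longleftrightarrow> g ` I \<in> indep (delete (contract M C) D)"
      using ind[of "g ` I"] gI T by simp
    also have "\<dots> \<longleftrightarrow> matroid_rank M (g ` I \<union> C) = card (g ` I) + matroid_rank M C"
      using gI by (auto simp: delete_def contract_def T_def)
    also have "card (g ` I) = card I"
      using I bij by (meson bij_betw_imp_inj_on card_image inj_on_subset)
    also have "matroid_rank M (g ` I \<union> C) = card I + matroid_rank M C \<longleftrightarrow>
        int (matroid_rank M (g ` I \<union> C)) - int (matroid_rank M C) = int (card I)"
      by linarith
    also have "\<dots> \<longleftrightarrow> r (g ` I \<union> C) - r C = int (card I)"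
      using gI CD by (subst (1 2) r) (auto simp: T_def)
    finally show "I \<in> indep L \<longleftrightarrow> r (g ` I \<union> C) - r C = int (card I)" .
  qed
next
  assume "rank_minor (ground M) r L"
  then obtain C g where C: "C \<subseteq> ground M" and inj: "inj_on g (ground L)"
    and g: "g ` ground L \<subseteq> ground M - C"
    and ind: "\<And>I. I \<subseteq> ground L \<Longrightarrow> (I \<in> indep L \<longleftrightarrow> r (g ` I \<union> C) - r C = int (card I))"
    unfolding rank_minor_def by blast
  define T where "T = g ` ground L"
  define D where "D = ground M - C - T"
  have T: "ground (delete (contract M C) D) = T"
    using g by (auto simp: T_def D_def delete_def contract_def)
  define f where "f = the_inv_into (ground L) g"
  have bij: "bij_betw f T (ground L)"
    using inj unfolding T_def f_def by (intro bij_betw_the_inv_into) (simp add: bij_betw_def)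
  have gf: "g (f x) = x" if "x \<in> T" for x
    using inj that unfolding f_def T_def by (simp add: f_the_inv_into_f)
  have "matroid_iso (delete (contract M C) D) L"
    unfolding matroid_iso_def
  proof (intro exI conjI allI impI)
    show "bij_betw f (ground (delete (contract M C) D)) (ground L)"
      using bij T by simp
    fix I assume "I \<subseteq> ground (delete (contract M C) D)"
    then have I: "I \<subseteq> T" by (simp add: T)
    have fI: "f ` I \<subseteq> ground L" using I bij by (auto simp: bij_betw_def)
    have "g ` f ` I = I" using I gf by (force simp: image_iff)
    moreover have "card (f ` I) = card I"
      using I bij by (meson bij_betw_imp_inj_on card_image inj_on_subset)
    ultimately have "f ` I \<in> indep L \<longleftrightarrow> r (I \<union> C) - r C = int (card I)"
      using ind[OF fI] by simp
    also have "\<dots> \<longleftrightarrow> int (matroid_rank M (I \<union> C)) - int (matroid_rank M C) = int (card I)"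
      using I g C by (subst (1 2) r) (auto simp: T_def)
    also have "\<dots> \<longleftrightarrow> matroid_rank M (I \<union> C) = card I + matroid_rank M C"
      by linarith
    also have "\<dots> \<longleftrightarrow> I \<in> indep (delete (contract M C) D)"
      using I g by (auto simp: delete_def contract_def T_def D_def)
    finally show "I \<in> indep (delete (contract M C) D) \<longleftrightarrow> f ` I \<in> indep L" by simp
  qed
  moreover have "is_minor (delete (contract M C) D) M"
    unfolding is_minor_def using C by (intro exI[of _ C] exI[of _ D]) (auto simp: D_def)
  ultimately show "has_minor M L" unfolding has_minor_def by blast
qed

text \<open>A minor of a minor contracts \<open>C\<close> together with the image of
  \<open>C'\<close>; the two occurrences of \<open>r C\<close> cancel.\<close>

lemma rank_minor_trans:
  assumes C: "C \<subseteq> E" and g: "inj_on g T" "g ` T \<subseteq> E - C"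
    and minor: "rank_minor T (\<lambda>X. r (g ` X \<union> C) - r C) L"
  shows "rank_minor E r L"
proof -
  obtain C' h where C': "C' \<subseteq> T" and h: "inj_on h (ground L)" "h ` ground L \<subseteq> T - C'"
    and ind: "\<And>I. I \<subseteq> ground L \<Longrightarrow> (I \<in> indep L \<longleftrightarrow>
      r (g ` (h ` I \<union> C') \<union> C) - r C - (r (g ` C' \<union> C) - r C) = int (card I))"
    using minor unfolding rank_minor_def by blast
  show ?thesis
    unfolding rank_minor_def
  proof (intro exI[of _ "g ` C' \<union> C"] exI[of _ "g \<circ> h"] conjI allI impI)
    show "g ` C' \<union> C \<subseteq> E" using C C' g by auto
    show "inj_on (g \<circ> h) (ground L)"
      using g h by (meson Diff_subset comp_inj_on inj_on_subset order_trans)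
    show "(g \<circ> h) ` ground L \<subseteq> E - (g ` C' \<union> C)"
    proof (intro image_subsetI)
      fix x assume "x \<in> ground L"
      then have hx: "h x \<in> T" "h x \<notin> C'" using h by auto
      then have "g (h x) \<notin> g ` C'" using g(1) C' by (simp add: inj_on_image_mem_iff)
      then show "(g \<circ> h) x \<in> E - (g ` C' \<union> C)" using g(2) hx by auto
    qed
    fix I assume "I \<subseteq> ground L"
    moreover have "g ` (h ` I \<union> C') \<union> C = (g \<circ> h) ` I \<union> (g ` C' \<union> C)" by auto
    ultimately show "I \<in> indep L \<longleftrightarrow>
        r ((g \<circ> h) ` I \<union> (g ` C' \<union> C)) - r (g ` C' \<union> C) = int (card I)"
      using ind[of I] by simp
  qed
qed

section \<open>From one-element extensions to quotients\<close>

lemma inj_Some_image_eq_iff: "Some ` A = Some ` B \<longleftrightarrow> A = B"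
  by (simp add: inj_image_eq_iff)

text \<open>The difference \<open>q X - p X\<close> is the rank of the new element minus its gain
  over \<open>X\<close>. By diminishing returns it grows with \<open>X\<close>, and it never exceeds
  the rank of a single element.\<close>

lemma quotient_of_extension:
  assumes K: "is_matroid K" "None \<in> ground K"
    and Q: "delete K {None} = map_matroid Some Q"
    and P: "contract K {None} = map_matroid Some P"
  shows "\<exists>p q. rank_quotient (ground Q) p q \<and>
    (\<forall>X. X \<subseteq> ground Q \<longrightarrow> int (matroid_rank Q X) = q X \<and> int (matroid_rank P X) = p X)"
proof -
  define E where "E = ground Q"
  define R where "R X = int (matroid_rank K X)" for X
  interpret R: rank_function "ground K" R
    unfolding R_def using K(1) by (rule matroid_rank_function)
  define C where "C = {None :: 'a option}"
  have gK: "ground K - C = Some ` E"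
    using arg_cong[OF Q, of ground] by (simp add: delete_def map_matroid_def E_def C_def)
  have C: "C \<subseteq> ground K" using K(2) by (simp add: C_def)
  have E: "Some ` E \<subseteq> ground K" using gK by auto
  have finE: "finite E"
    using R.finite_ground E by (meson finite_imageD finite_subset inj_Some)
  \<comment> \<open>The empty set in \<open>q\<close> makes the deletion an instance of
    \<open>minor_rank_function\<close>, just like the contraction.\<close>
  define p q where "p X = R (Some ` X \<union> C) - R C" and "q X = R (Some ` X \<union> {}) - R {}"
    for X :: "'a set"
  interpret p: rank_function E p
    unfolding p_def using C finE E by (intro R.minor_rank_function) auto
  interpret q: rank_function E q
    unfolding q_def using finE E by (intro R.minor_rank_function) auto
  have quot: "rank_quotient E p q"
  proof
    fix X Y assume XY: "X \<subseteq> Y" "Y \<subseteq> E"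
    have "R (Some ` Y \<union> C) - R (Some ` Y) \<le> R (Some ` X \<union> C) - R (Some ` X)"
      using XY E C by (intro R.rank_diminishing) auto
    then show "p Y - p X \<le> q Y - q X" by (simp add: p_def q_def)
  next
    have "R (Some ` E) \<le> R (Some ` E \<union> C)" using E C by (intro R.rank_mono) auto
    moreover have "R C \<le> 1" using R.rank_le_card[OF C] by (simp add: C_def)
    ultimately show "q E \<le> p E + 1" using R.rank_empty by (simp add: p_def q_def)
  qed
  have mem: "I \<in> indep L \<longleftrightarrow> Some ` I \<in> indep (map_matroid Some L)" for I and L :: "'a matroid"
    by (auto simp: map_matroid_def inj_Some_image_eq_iff)
  have indQ: "indep Q = {I. I \<subseteq> E \<and> q I = int (card I)}"
  proof (intro set_eqI)
    fix I
    have "I \<in> indep Q \<longleftrightarrow> Some ` I \<in> indep K"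
      unfolding mem[of I] Q[symmetric] by (auto simp: delete_def)
    also have "\<dots> \<longleftrightarrow> Some ` I \<subseteq> ground K - C \<and> R (Some ` I) = int (card I)"
      unfolding indep_iff_rank[OF K(1)] by (auto simp: R_def C_def card_image)
    also have "\<dots> \<longleftrightarrow> I \<in> {I. I \<subseteq> E \<and> q I = int (card I)}"
      unfolding gK using R.rank_empty by (auto simp: q_def)
    finally show "I \<in> indep Q \<longleftrightarrow> I \<in> {I. I \<subseteq> E \<and> q I = int (card I)}" .
  qed
  have indP: "indep P = {I. I \<subseteq> E \<and> p I = int (card I)}"
  proof (intro set_eqI)
    fix I
    have "I \<in> indep P \<longleftrightarrow> Some ` I \<in> indep (contract K C)"
      unfolding mem[of I] P[symmetric] C_def ..
    also have "\<dots> \<longleftrightarrow> Some ` I \<subseteq> ground K - C \<and> R (Some ` I \<union> C) - R C = int (card I)"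
      by (auto simp: contract_def R_def card_image)
    also have "\<dots> \<longleftrightarrow> I \<in> {I. I \<subseteq> E \<and> p I = int (card I)}"
      unfolding gK by (auto simp: p_def)
    finally show "I \<in> indep P \<longleftrightarrow> I \<in> {I. I \<subseteq> E \<and> p I = int (card I)}" .
  qed
  show ?thesis
    using quot p.matroid_rank_eq[OF indP] q.matroid_rank_eq[OF indQ] unfolding E_def by blast
qed

section \<open>Uniform minors\<close>

text \<open>If each good set of fewer than \<open>k\<close> elements has at most one bad one-element extension,
  then \<open>Y\<close> can be built greedily: each \<open>y\<close> that cannot be added to \<open>Y\<close> is the bad extension
  of some subset of \<open>Y\<close>, so at most \<open>2 ^ card Y\<close> elements are excluded.\<close>

lemma greedy_subset:
  assumes E: "finite E" and good: "good {}"
    and unique: "\<And>Z y y'. Z \<subseteq> E \<Longrightarrow> card Z < k \<Longrightarrow> good Z \<Longrightarrow> y \<in> E - Z \<Longrightarrow> y' \<in> E - Z \<Longrightarrow>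
      \<not> good (insert y Z) \<Longrightarrow> \<not> good (insert y' Z) \<Longrightarrow> y = y'"
    and large: "t + 2 ^ t \<le> card E"
  shows "\<exists>Y\<subseteq>E. card Y = t \<and> (\<forall>Z\<subseteq>Y. card Z \<le> k \<longrightarrow> good Z)"
  using large
proof (induction t)
  case 0
  then show ?case using good by (intro exI[of _ "{}"]) auto
next
  case (Suc t)
  then obtain Y where Y: "Y \<subseteq> E" "card Y = t" "\<And>Z. Z \<subseteq> Y \<Longrightarrow> card Z \<le> k \<Longrightarrow> good Z"
    by auto
  have finY: "finite Y" using Y(1) E by (rule finite_subset)
  define bad where "bad = {y \<in> E - Y. \<exists>Z\<subseteq>Y. card Z < k \<and> \<not> good (insert y Z)}"
  then have "\<forall>y\<in>bad. \<exists>Z\<subseteq>Y. card Z < k \<and> \<not> good (insert y Z)"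
    by blast
  then obtain w where w: "\<And>y. y \<in> bad \<Longrightarrow> w y \<subseteq> Y \<and> card (w y) < k \<and> \<not> good (insert y (w y))"
    by metis
  have "inj_on w bad"
  proof (rule inj_onI)
    fix y y' assume yy: "y \<in> bad" "y' \<in> bad" "w y = w y'"
    then have "y \<in> E - Y" "y' \<in> E - Y" by (auto simp: bad_def)
    then show "y = y'"
      using unique[of "w y" y y'] w[OF yy(1)] w[OF yy(2)] yy(3) Y(1) Y(3)[of "w y"] by auto
  qed
  moreover have "w ` bad \<subseteq> Pow Y" using w by blast
  ultimately have "card bad \<le> card (Pow Y)"
    using finY by (intro card_inj_on_le) auto
  then have "card bad \<le> 2 ^ t" using Y finY by (simp add: card_Pow)
  moreover have "card (E - Y) = card E - t" using Y finY by (simp add: card_Diff_subset)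
  moreover have "Suc t + 2 ^ t \<le> card E" using Suc.prems by simp
  ultimately have "card bad < card (E - Y)" by linarith
  then have "bad \<noteq> E - Y" by auto
  moreover have "bad \<subseteq> E - Y" by (auto simp: bad_def)
  ultimately obtain y where y: "y \<in> E - Y" "y \<notin> bad" by blast
  have "good Z" if Z: "Z \<subseteq> insert y Y" "card Z \<le> k" for Z
  proof (cases "y \<in> Z")
    case False
    then show ?thesis using Z Y(3) by blast
  next
    case True
    have "finite Z" using Z(1) finY finite_subset by auto
    then have "card (Z - {y}) < k" using True Z(2) card_Diff1_less[of Z y] by linarith
    moreover have "Z - {y} \<subseteq> Y" using Z(1) by blast
    ultimately have "good (insert y (Z - {y}))" using y unfolding bad_def by blast
    then show ?thesis using True by (simp add: insert_absorb)
  qed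
  then show ?case
    using y Y finY by (intro exI[of _ "insert y Y"]) auto
qed

text \<open>Any \<open>t\<close> elements of \<open>T\<close> carry the minor, so \<open>T\<close>
  may be larger than the ground set sought.\<close>

lemma rank_minor_uniformI:
  assumes C: "C \<subseteq> E" and T: "T \<subseteq> E - C" "finite T" "t \<le> card T"
    and ind: "\<And>X. X \<subseteq> T \<Longrightarrow> r (X \<union> C) - r C = int (card X) \<longleftrightarrow> card X \<le> s"
  shows "rank_minor E r (uniform s t)"
proof -
  obtain T' where T': "T' \<subseteq> T" "card T' = t"
    using T(3) by (rule obtain_subset_with_card_n)
  then have "finite T'" using T(2) finite_subset by blast
  then obtain g where g: "bij_betw g {..<t} T'"
    using ex_bij_betw_nat_finite[of T'] T' by (auto simp: atLeast0LessThan)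
  then have inj: "inj_on g {..<t}" and im: "g ` {..<t} = T'" by (auto simp: bij_betw_def)
  show ?thesis
    unfolding rank_minor_def
  proof (intro exI[of _ C] exI[of _ g] conjI allI impI)
    show "C \<subseteq> E" by fact
    show "inj_on g (ground (uniform s t))" using inj by (simp add: uniform_def)
    show "g ` ground (uniform s t) \<subseteq> E - C" using im T T' by (auto simp: uniform_def)
    fix I assume "I \<subseteq> ground (uniform s t)"
    then have I: "I \<subseteq> {..<t}" by (simp add: uniform_def)
    then have "card (g ` I) = card I" using inj by (meson card_image inj_on_subset)
    moreover have "g ` I \<subseteq> T" using I im T' by blast
    ultimately show "I \<in> indep (uniform s t) \<longleftrightarrow> r (g ` I \<union> C) - r C = int (card I)"
      using ind[of "g ` I"] I by (simp add: uniform_def)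
  qed
qed

text \<open>Contracting \<open>b - s\<close> elements of \<open>T\<close> lowers the rank from
  \<open>b\<close> to \<open>s\<close> and leaves at least \<open>t\<close> elements.\<close>

lemma uniform_rank_minor_uniform:
  assumes T: "T \<subseteq> E" "finite T" and r: "\<And>X. X \<subseteq> T \<Longrightarrow> r X = int (min (card X) b)"
    and "s \<le> b" "b + t \<le> card T + s"
  shows "rank_minor E r (uniform s t)"
proof -
  have "b - s \<le> card T" using assms(5) by linarith
  then obtain C where C: "C \<subseteq> T" "card C = b - s"
    by (rule obtain_subset_with_card_n)
  have finC: "finite C" using C(1) T(2) by (rule finite_subset)
  show ?thesis
  proof (rule rank_minor_uniformI[of C _ "T - C"])
    show "C \<subseteq> E" "T - C \<subseteq> E - C" "finite (T - C)" using C T by auto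
    show "t \<le> card (T - C)" using C T finC assms(4,5) by (simp add: card_Diff_subset)
    fix X assume X: "X \<subseteq> T - C"
    then have "card (X \<union> C) = card X + card C"
      using T finC by (intro card_Un_disjoint) (auto intro: finite_subset)
    moreover have "r (X \<union> C) = int (min (card (X \<union> C)) b)" using X C by (intro r) auto
    moreover have "r C = int (min (card C) b)" using C by (intro r)
    ultimately show "r (X \<union> C) - r C = int (card X) \<longleftrightarrow> card X \<le> s"
      using C(2) \<open>s \<le> b\<close> by (auto simp: min_def)
  qed
qed

text \<open>A set of more than \<open>b\<close> elements contains an independent set of size
  \<open>b\<close>, and none of its bases is larger.\<close>

lemma (in rank_function) uniform_rank_eq:
  assumes ind: "\<And>X. X \<subseteq> E \<Longrightarrow> r X = int (card X) \<longleftrightarrow> card X \<le> b" and X: "X \<subseteq> E"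
  shows "r X = int (min (card X) b)"
proof (cases "card X \<le> b")
  case True
  then show ?thesis using ind[OF X] by simp
next
  case False
  obtain J where J: "J \<subseteq> X" "r J = int (card J)" "r J = r X"
    using basis_exists[OF X] by blast
  then have "card J \<le> b" using ind[of J] X by auto
  moreover obtain I where I: "I \<subseteq> X" "card I = b"
    using False obtain_subset_with_card_n[of b X] by auto
  then have "r I = int b" using ind[of I] X by auto
  then have "int b \<le> r X" using I rank_mono[of I X] X by simp
  ultimately show ?thesis using J False by simp
qed

text \<open>In the quotient \<open>p\<close> a set of at most \<open>2 s\<close> elements has nullity at most one, so a hyperplane
  of \<open>p\<close> of rank \<open>2 s - 2\<close> has at most \<open>2 s - 1\<close> elements. This makes the greedy choice possible.\<close>

lemma uniform_quotient_restricted: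
  assumes "rank_quotient T p q" and q: "\<And>X. X \<subseteq> T \<Longrightarrow> q X = int (min (card X) (2 * s))"
    and s: "s \<ge> 1" and large: "3 * s - 1 + 2 ^ (3 * s - 1) \<le> card T"
  shows "rank_minor T p (uniform s (2 * s))"
proof -
  interpret rank_quotient T p q by fact
  note finT = p.finite_ground
  have "(1::nat) \<le> 2 ^ (3 * s - 1)" by simp
  then have cardT: "3 * s \<le> card T" using large by linarith
  show ?thesis
  proof (cases "q T = p T")
    case True
    then have "p X = int (min (card X) (2 * s))" if "X \<subseteq> T" for X
      using quotient_eq_subset[of T X] q[of X] that by simp
    then show ?thesis
      using finT cardT by (intro uniform_rank_minor_uniform[of T _ _ "2 * s"]) auto
  next
    case False
    \<comment> \<open>This bound caps the rank at \<open>s\<close> once \<open>s - 1\<close>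
      independent elements are contracted.\<close>
    have pT: "p T < 2 * int s"
      using False quotient_le[of T] q[of T] by simp
    obtain Y where Y: "Y \<subseteq> T" "card Y = 3 * s - 1"
      "\<And>Z. Z \<subseteq> Y \<Longrightarrow> card Z \<le> 2 * s - 1 \<Longrightarrow> q Z = p Z"
    proof -
      have "\<exists>Y\<subseteq>T. card Y = 3 * s - 1 \<and> (\<forall>Z\<subseteq>Y. card Z \<le> 2 * s - 1 \<longrightarrow> q Z = p Z)"
      proof (rule greedy_subset[OF finT _ _ large])
        show "q {} = p {}" using p.rank_empty q.rank_empty by simp
        fix Z y y'
        assume Z: "Z \<subseteq> T" "card Z < 2 * s - 1" "q Z = p Z"
          and y: "y \<in> T - Z" "y' \<in> T - Z"
          and bad: "q (insert y Z) \<noteq> p (insert y Z)" "q (insert y' Z) \<noteq> p (insert y' Z)"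
        have finZ: "finite Z" using Z(1) by (rule p.finite_subset_ground)
        \<comment> \<open>A bad element lies in the \<open>p\<close>-closure of \<open>Z\<close>: it
          makes \<delta> jump from zero to one, so the gain in \<open>q\<close> is not matched in
          \<open>p\<close>.\<close>
        have flat: "p (insert x Z) = p Z" if "x \<in> T - Z" "q (insert x Z) \<noteq> p (insert x Z)" for x
        proof -
          have "p Z \<le> p (insert x Z)" using that Z by (intro p.rank_mono) auto
          moreover have "p (insert x Z) \<le> q (insert x Z)" using that Z by (intro quotient_le) auto
          moreover have "q (insert x Z) \<le> q Z + 1" using that Z by (intro q.rank_insert_le) auto
          ultimately show ?thesis using that(2) Z(3) by linarith
        qed
        show "y = y'"
        proof (rule ccontr)
          assume "y \<noteq> y'"
          then have card: "card (Z \<union> {y, y'}) = card Z + 2" using y finZ by simp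
          \<comment> \<open>Two bad elements would raise \<open>q\<close> by two, as
            \<open>card Z + 2 \<le> 2 * s\<close>, and \<open>p\<close> not at all, against \<delta>
            \<le> 1.\<close>
          have "p (Z \<union> {y, y'}) = p Z"
            using Z y bad by (intro p.rank_closure) (auto intro: flat)
          moreover have "q (Z \<union> {y, y'}) \<le> p (Z \<union> {y, y'}) + 1"
            using Z y by (intro quotient_ge) auto
          moreover have "q (Z \<union> {y, y'}) = int (min (card (Z \<union> {y, y'})) (2 * s))"
            using Z y by (intro q) auto
          moreover have "q Z = int (min (card Z) (2 * s))" using Z by (intro q)
          ultimately show False using card Z(2,3) by simp
        qed
      qed
      then show thesis using that by blast
    qed
    have finY: "finite Y" using Y(1) by (rule p.finite_subset_ground)
    \<comment> \<open>Removing \<open>s - 1\<close> of the \<open>3 * s - 1\<close> elements leaves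
      \<open>2 * s\<close>. A set of \<open>s\<close> of these together with \<open>C\<close> has
      \<open>2 * s - 1\<close> elements, the largest size for which the greedy choice guarantees
      independence in \<open>p\<close>.\<close>
    have "s - 1 \<le> card Y" using Y(2) by linarith
    then obtain C where C: "C \<subseteq> Y" "card C = s - 1"
      by (rule obtain_subset_with_card_n)
    have finC: "finite C" using C(1) finY by (rule finite_subset)
    have small: "p X = int (card X)" if "X \<subseteq> Y" "card X \<le> 2 * s - 1" for X
      using Y(1) Y(3)[of X] q[of X] that by simp
    show ?thesis
    proof (rule rank_minor_uniformI[of C _ "Y - C"])
      show "C \<subseteq> T" "Y - C \<subseteq> T - C" "finite (Y - C)" using C Y finY by auto
      show "2 * s \<le> card (Y - C)" using C Y finC s by (simp add: card_Diff_subset)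
      fix X assume X: "X \<subseteq> Y - C"
      then have card: "card (X \<union> C) = card X + (s - 1)"
        using finY finC C(2) by (subst card_Un_disjoint) (auto intro: finite_subset)
      have pC: "p C = int (s - 1)" using C small[of C] by simp
      show "p (X \<union> C) - p C = int (card X) \<longleftrightarrow> card X \<le> s"
      proof (cases "card X \<le> s")
        case True
        then have "p (X \<union> C) = int (card (X \<union> C))"
          using X C card s by (intro small) auto
        then show ?thesis using True card pC by simp
      next
        case False
        have "p (X \<union> C) \<le> p T" using X C Y by (intro p.rank_mono) auto
        then show ?thesis using False pT pC s by auto
      qed
    qed
  qed
qed

text \<open>Contracting \<open>a - 2 * s\<close> elements first brings the rank of \<open>q\<close>
  down to \<open>2 * s\<close>, so that the greedy bound is exponential in \<open>s\<close> only and
  not in \<open>a\<close>.\<close>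

lemma uniform_quotient_rank_minor:
  assumes "rank_quotient E p q" and q: "\<And>X. X \<subseteq> E \<Longrightarrow> q X = int (min (card X) a)"
    and s: "s \<ge> 1" "2 * s \<le> a" and large: "s - 1 + 2 ^ (3 * s - 1) + a \<le> card E"
  shows "rank_minor E p (uniform s (2 * s))"
proof -
  interpret rank_quotient E p q by fact
  have "a - 2 * s \<le> card E" using large by linarith
  then obtain C where C: "C \<subseteq> E" "card C = a - 2 * s"
    by (rule obtain_subset_with_card_n)
  have finC: "finite C" using C(1) by (rule p.finite_subset_ground)
  have "rank_minor (E - C) (\<lambda>X. p ((\<lambda>x. x) ` X \<union> C) - p C) (uniform s (2 * s))"
  proof (rule uniform_quotient_restricted[OF minor_rank_quotient])
    fix X assume X: "X \<subseteq> E - C"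
    then have "card (X \<union> C) = card X + card C"
      using p.finite_ground finC by (intro card_Un_disjoint) (auto intro: finite_subset)
    moreover have "q (X \<union> C) = int (min (card (X \<union> C)) a)" using X C by (intro q) auto
    moreover have "q C = int (min (card C) a)" using C by (intro q)
    ultimately show "q ((\<lambda>x. x) ` X \<union> C) - q C = int (min (card X) (2 * s))"
      using C(2) s by (auto simp: min_def)
  next
    have "3 * s - 1 = 2 * s + (s - 1)" using s by simp
    then show "3 * s - 1 + 2 ^ (3 * s - 1) \<le> card (E - C)"
      using C finC large s by (simp add: card_Diff_subset)
  qed (use C s p.finite_ground in auto)
  then show ?thesis using C(1) by (rule rank_minor_trans[rotated 3]) auto
qed

text \<open>The dual of the previous greedy choice: the good sets are those whose complement in \<open>T\<close>
  has the larger rank \<open>a + 1\<close>.\<close>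

lemma uniform_lift_rank_minor:
  assumes "rank_quotient E p q" and p: "\<And>X. X \<subseteq> E \<Longrightarrow> p X = int (min (card X) a)"
    and s: "s \<ge> 1" and large: "a + 2 * s \<le> card E" "s - 1 + 2 ^ (3 * s - 1) \<le> a"
  shows "rank_minor E q (uniform s (2 * s))"
proof -
  interpret rank_quotient E p q by fact
  \<comment> \<open>With this size, removing up to \<open>2 * s\<close> elements leaves a set of
    full rank \<open>a\<close> in \<open>p\<close>.\<close>
  obtain T where T: "T \<subseteq> E" "card T = a + 2 * s"
    using large(1) by (rule obtain_subset_with_card_n)
  have finT: "finite T" using T(1) by (rule p.finite_subset_ground)
  have "(1::nat) \<le> 2 ^ (3 * s - 1)" by simp
  then have as: "s \<le> a" using large(2) by linarith
  show ?thesis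
  proof (cases "q T = p T")
    case True
    then have "q X = int (min (card X) a)" if "X \<subseteq> T" for X
      using quotient_eq_subset[of T X] p[of X] that T by auto
    then show ?thesis
      using finT T as by (intro uniform_rank_minor_uniform[of T _ _ a]) auto
  next
    case False
    then have qT: "q T = int a + 1"
      using quotient_le[of T] quotient_ge[of T] p[of T] T by simp
    obtain Y where Y: "Y \<subseteq> T" "card Y = 3 * s - 1"
      "\<And>Z. Z \<subseteq> Y \<Longrightarrow> card Z \<le> 2 * s - 1 \<Longrightarrow> q (T - Z) = int a + 1"
    proof -
      have "\<exists>Y\<subseteq>T. card Y = 3 * s - 1 \<and> (\<forall>Z\<subseteq>Y. card Z \<le> 2 * s - 1 \<longrightarrow> q (T - Z) = int a + 1)"
      proof (rule greedy_subset[OF finT])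
        show "q (T - {}) = int a + 1" using qT by simp
        have "3 * s - 1 = 2 * s + (s - 1)" using s by simp
        then show "3 * s - 1 + 2 ^ (3 * s - 1) \<le> card T" using large(2) T(2) by simp
        fix Z y y'
        assume Z: "Z \<subseteq> T" "card Z < 2 * s - 1" "q (T - Z) = int a + 1"
          and y: "y \<in> T - Z" "y' \<in> T - Z"
          and bad: "q (T - insert y Z) \<noteq> int a + 1" "q (T - insert y' Z) \<noteq> int a + 1"
        have finZ: "finite Z" using Z(1) finT by (rule finite_subset)
        have le: "q (T - insert x Z) \<le> int a" if "q (T - insert x Z) \<noteq> int a + 1" for x
        proof -
          have "q (T - insert x Z) \<le> q T" using T by (intro q.rank_mono) auto
          then show ?thesis using that qT by linarith
        qed
        show "y = y'"
        proof (rule ccontr)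
          assume "y \<noteq> y'"
          \<comment> \<open>Here \<open>card Z + 2 \<le> 2 * s\<close>, so \<open>W\<close> still
            has \<open>q\<close>-rank at least \<open>a\<close>. Submodularity then bounds the sum
            of \<open>a + 1\<close> and \<open>a\<close> by twice \<open>a\<close>, a
            contradiction.\<close>
          define W where "W = T - insert y (insert y' Z)"
          have "card (insert y (insert y' Z)) = card Z + 2" using y \<open>y \<noteq> y'\<close> finZ by simp
          then have "a \<le> card W"
            unfolding W_def using Z y T finZ by (subst card_Diff_subset) auto
          then have "int a \<le> q W"
            using p[of W] quotient_le[of W] T by (auto simp: W_def)
          moreover have "q ((T - insert y Z) \<union> (T - insert y' Z))
              + q ((T - insert y Z) \<inter> (T - insert y' Z)) \<le> q (T - insert y Z) + q (T - insert y' Z)"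
            using T by (intro q.rank_submodular) auto
          moreover have "(T - insert y Z) \<union> (T - insert y' Z) = T - Z"
            using \<open>y \<noteq> y'\<close> by auto
          moreover have "(T - insert y Z) \<inter> (T - insert y' Z) = W"
            by (auto simp: W_def)
          ultimately show False using le[OF bad(1)] le[OF bad(2)] Z(3) by simp
        qed
      qed
      then show thesis using that by blast
    qed
    have finY: "finite Y" using Y(1) finT by (rule finite_subset)
    \<comment> \<open>Contracting the complement of \<open>Y\<close> is dual to restricting to
      \<open>Y\<close>. It has \<open>a + 1 - s\<close> elements, which takes the rank of
      \<open>q\<close> from \<open>a + 1\<close> to \<open>s\<close>.\<close>
    define C where "C = T - Y"
    have C: "C \<subseteq> T" "card C = a + 1 - s"
      using T Y finY s as by (auto simp: C_def card_Diff_subset)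
    have finC: "finite C" using C(1) finT by (rule finite_subset)
    \<comment> \<open>Sets independent in the quotient \<open>p\<close> are independent in
      \<open>q\<close>.\<close>
    have small: "q X = int (card X)" if "X \<subseteq> T" "card X \<le> a" for X
      using quotient_le[of X] q.rank_le_card[of X] p[of X] that T(1) subset_trans[of X T E] by simp
    have qC: "q C = int (card C)" using C s by (intro small) auto
    show ?thesis
    proof (rule rank_minor_uniformI[of C _ Y])
      show "C \<subseteq> E" "Y \<subseteq> E - C" "finite Y" using C Y T finY by (auto simp: C_def)
      show "2 * s \<le> card Y" using Y s by simp
      fix X assume X: "X \<subseteq> Y"
      then have finX: "finite X" using finY finite_subset by blast
      have card: "card (X \<union> C) = card X + card C"
        using X finX finC by (intro card_Un_disjoint) (auto simp: C_def)
      consider "card X < s" | "card X = s" | "card X > s" by linarith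
      then show "q (X \<union> C) - q C = int (card X) \<longleftrightarrow> card X \<le> s"
      proof cases
        case 1
        then have "q (X \<union> C) = int (card (X \<union> C))"
          using X C Y card as by (intro small) auto
        then show ?thesis using 1 card qC by simp
      next
        case 2
        \<comment> \<open>Only at \<open>card X = s\<close> does the union with \<open>C\<close>
          exceed \<open>a\<close> elements while it has to be independent. It is the complement in
          \<open>T\<close> of \<open>2 * s - 1\<close> elements of \<open>Y\<close>, so the greedy
          choice gives it rank \<open>a + 1\<close>.\<close>
        have "card (Y - X) = 2 * s - 1" using X Y finX 2 by (simp add: card_Diff_subset)
        then have "q (T - (Y - X)) = int a + 1" by (intro Y(3)) auto
        moreover have "T - (Y - X) = X \<union> C" using X Y by (auto simp: C_def)
        ultimately show ?thesis using 2 C(2) qC as by simp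
      next
        case 3
        have "q (X \<union> C) \<le> q T" using X C Y T by (intro q.rank_mono) auto
        then show ?thesis using 3 C(2) qC qT as by auto
      qed
    qed
  qed
qed

section \<open>Projective geometry minors\<close>

definition coord_unit :: "nat \<Rightarrow> nat \<Rightarrow> 'f::field" where
  "coord_unit i = (\<lambda>j. if j = i then 1 else 0)"

lemma subspace_coord: "coord.subspace {v :: nat \<Rightarrow> 'f::field. \<forall>i>d. v i = 0}"
  by (auto simp: coord.subspace_def coord_scale_def)

lemma span_nonzero_in_line:
  assumes "u \<in> coord.span {v}" "u \<noteq> 0"
  shows "coord.span {u} = coord.span {v}"
proof -
  obtain c where c: "u = coord_scale c v"
    using assms(1) by (auto simp: coord.span_singleton)
  then have "c \<noteq> 0" using assms(2) by auto
  then have "v = coord_scale (inverse c) u" using c by (simp add: coord_scale_def mult.assoc[symmetric])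
  then have "v \<in> coord.span {u}" by (metis coord.span_base coord.span_scale singletonI)
  then show ?thesis using assms(1) by (simp add: coord.span_eq)
qed

lemma PG_points_iff:
  "L \<in> PG_points d \<longleftrightarrow> (\<exists>v. v \<noteq> 0 \<and> (\<forall>i>d. v i = 0) \<and> L = coord.span {v})"
proof
  assume "L \<in> PG_points d"
  then have L: "coord.subspace L" "L \<subseteq> {v. \<forall>i>d. v i = 0}" "coord.dim L = 1"
    by (auto simp: PG_points_def)
  obtain B where B: "B \<subseteq> L" "coord.independent B" "L \<subseteq> coord.span B" "card B = coord.dim L"
    by (rule coord.basis_exists)
  then obtain v where v: "B = {v}" using L(3) by (metis card_1_singletonE)
  then have "L = coord.span {v}" using B L(1) by (metis coord.span_subspace)
  moreover have "v \<noteq> 0" using B(2) v by simp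
  ultimately show "\<exists>v. v \<noteq> 0 \<and> (\<forall>i>d. v i = 0) \<and> L = coord.span {v}"
    using B(1) L(2) v by (intro exI[of _ v]) auto
next
  assume "\<exists>v. v \<noteq> 0 \<and> (\<forall>i>d. v i = 0) \<and> L = coord.span {v}"
  then obtain v where v: "v \<noteq> 0" "\<forall>i>d. v i = 0" "L = coord.span {v}" by blast
  have "coord.span {v} \<subseteq> {v. \<forall>i>d. v i = 0}"
    using v(2) subspace_coord by (intro coord.span_minimal) auto
  moreover have "coord.dim (coord.span {v}) = 1"
    using v(1) by (subst coord.dim_span_eq_card_independent) auto
  ultimately show "L \<in> PG_points d" by (auto simp: PG_points_def v(3))
qed

text \<open>A basis inside \<open>S\<close> with as many elements as \<open>S\<close> is
  \<open>S\<close> itself.\<close>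

lemma independent_if_dim_eq_card:
  assumes "finite S" "coord.dim S = card S"
  shows "coord.independent S"
proof -
  obtain B where "B \<subseteq> S" "coord.independent B" "card B = coord.dim S"
    by (rule coord.basis_exists)
  then show ?thesis using assms by (metis card_subset_eq)
qed

lemma coord_unit_nonzero: "coord_unit i \<noteq> (0 :: nat \<Rightarrow> 'f::field)"
  by (auto simp: coord_unit_def fun_eq_iff)

lemma inj_coord_unit: "inj (coord_unit :: nat \<Rightarrow> nat \<Rightarrow> 'f::field)"
  by (auto simp: inj_def coord_unit_def fun_eq_iff)

text \<open>The vectors before \<open>coord_unit n\<close> lie in the subspace where coordinate
  \<open>n\<close> vanishes; \<open>coord_unit n\<close> does not.\<close>

lemma independent_coord_unit:
  "coord.independent (coord_unit ` {..<n} :: (nat \<Rightarrow> 'f::field) set)"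
proof (induction n)
  case (Suc n)
  have "coord.subspace {v :: nat \<Rightarrow> 'f. v n = 0}"
    by (auto simp: coord.subspace_def coord_scale_def)
  then have "coord.span (coord_unit ` {..<n}) \<subseteq> {v :: nat \<Rightarrow> 'f. v n = 0}"
    by (intro coord.span_minimal) (auto simp: coord_unit_def)
  then have "(coord_unit n :: nat \<Rightarrow> 'f) \<notin> coord.span (coord_unit ` {..<n})"
    by (auto simp: coord_unit_def)
  then show ?case
    using coord.independent_insertI[OF _ Suc] by (simp add: lessThan_Suc)
qed (use coord.independent_empty in simp)

lemma span_coord_unit:
  "coord.span (coord_unit ` {..<n}) = {v :: nat \<Rightarrow> 'f::field. \<forall>i\<ge>n. v i = 0}"
proof
  have "coord.subspace {v :: nat \<Rightarrow> 'f. \<forall>i\<ge>n. v i = 0}"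
    by (auto simp: coord.subspace_def coord_scale_def)
  then show "coord.span (coord_unit ` {..<n}) \<subseteq> {v :: nat \<Rightarrow> 'f. \<forall>i\<ge>n. v i = 0}"
    by (intro coord.span_minimal) (auto simp: coord_unit_def)
  have "v \<in> coord.span (coord_unit ` {..<n})" if "\<forall>i\<ge>n. v i = 0" for v :: "nat \<Rightarrow> 'f"
    using that
  proof (induction n arbitrary: v)
    case 0
    then have "v = 0" by (auto simp: fun_eq_iff)
    then show ?case using coord.span_zero by metis
  next
    case (Suc n)
    define w where "w = v - coord_scale (v n) (coord_unit n)"
    have "w i = 0" if "i \<ge> n" for i
    proof (cases "i = n")
      case False
      then show ?thesis
        using Suc.prems that by (simp add: w_def coord_scale_def coord_unit_def)
    qed (simp add: w_def coord_scale_def coord_unit_def)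
    then have "w \<in> coord.span (coord_unit ` {..<n})" by (intro Suc.IH) auto
    then have "w \<in> coord.span (coord_unit ` {..<Suc n})"
      by (rule subsetD[OF coord.span_mono, rotated]) auto
    moreover have "coord_scale (v n) (coord_unit n) \<in> coord.span (coord_unit ` {..<Suc n})"
      by (intro coord.span_scale coord.span_base) auto
    ultimately have "w + coord_scale (v n) (coord_unit n) \<in> coord.span (coord_unit ` {..<Suc n})"
      by (rule coord.span_add)
    then show ?case by (simp add: w_def)
  qed
  then show "{v :: nat \<Rightarrow> 'f. \<forall>i\<ge>n. v i = 0} \<subseteq> coord.span (coord_unit ` {..<n})" by blast
qed

text \<open>The standard frame is the basis that bounds the rank of the geometry from below and from
  which the closure under lines starts.\<close>

lemma coord_unit_points:
  fixes d :: nat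
  defines "B \<equiv> (\<lambda>i. coord.span {coord_unit i :: nat \<Rightarrow> 'f::field}) ` {..d}"
  shows "B \<subseteq> PG_points d" "card B = Suc d" "coord.dim (\<Union>B) = Suc d"
proof -
  show "B \<subseteq> PG_points d"
    using coord_unit_nonzero by (force simp: B_def PG_points_iff coord_unit_def)
  have "inj (\<lambda>i. coord.span {coord_unit i :: nat \<Rightarrow> 'f})"
  proof (rule injI)
    fix i j assume "coord.span {coord_unit i :: nat \<Rightarrow> 'f} = coord.span {coord_unit j}"
    then have "(coord_unit i :: nat \<Rightarrow> 'f) \<in> coord.span {coord_unit j}"
      by (metis coord.span_base singletonI)
    then obtain c :: 'f where "coord_unit i = coord_scale c (coord_unit j)"
      by (auto simp: coord.span_singleton)
    then have "coord_unit i i = coord_scale c (coord_unit j) i" by simp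
    then show "i = j" by (auto simp: coord_unit_def coord_scale_def split: if_splits)
  qed
  then show "card B = Suc d" unfolding B_def by (subst card_image) (auto intro: inj_on_subset)
  have "coord.span (\<Union>B) = coord.span (coord_unit ` {..<Suc d})"
    unfolding coord.span_eq
  proof
    have "coord.span {coord_unit i} \<subseteq> coord.span (coord_unit ` {..<Suc d} :: (nat \<Rightarrow> 'f) set)"
      if "i \<le> d" for i
      using that by (intro coord.span_mono) auto
    then show "\<Union>B \<subseteq> coord.span (coord_unit ` {..<Suc d})" by (auto simp: B_def)
    have "coord_unit i \<in> \<Union>B" if "i < Suc d" for i
      using that coord.span_base[of "coord_unit i :: nat \<Rightarrow> 'f" "{coord_unit i}"]
      by (auto simp: B_def less_Suc_eq_le)
    then show "coord_unit ` {..<Suc d} \<subseteq> coord.span (\<Union>B)" using coord.span_superset by blast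
  qed
  then have "coord.dim (\<Union>B) = coord.dim (coord_unit ` {..<Suc d} :: (nat \<Rightarrow> 'f) set)"
    by (rule coord.span_eq_dim)
  also have "\<dots> = card (coord_unit ` {..<Suc d} :: (nat \<Rightarrow> 'f) set)"
    by (intro coord.dim_eq_card_independent independent_coord_unit)
  also have "\<dots> = Suc d"
    by (simp add: card_image[OF inj_on_subset[OF inj_coord_unit subset_UNIV]])
  finally show "coord.dim (\<Union>B) = Suc d" .
qed

section \<open>Flats as smaller projective geometries\<close>

lemma coord_dim_image:
  assumes \<phi>: "Vector_Spaces.linear coord_scale coord_scale \<phi>" and inj: "inj_on \<phi> (coord.span S)"
  shows "coord.dim (\<phi> ` S) = coord.dim S"
proof -
  interpret \<phi>: Vector_Spaces.linear coord_scale coord_scale \<phi> by fact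
  obtain B where B: "B \<subseteq> S" "coord.independent B" "S \<subseteq> coord.span B" "card B = coord.dim S"
    by (rule coord.basis_exists)
  have injB: "inj_on \<phi> (coord.span B)"
    using inj coord.span_mono[OF B(1)] by (rule inj_on_subset)
  have "card (\<phi> ` B) = coord.dim (\<phi> ` S)"
  proof (rule coord.basis_card_eq_dim)
    show "\<phi> ` B \<subseteq> \<phi> ` S" using B(1) by auto
    show "\<phi> ` S \<subseteq> coord.span (\<phi> ` B)" using B(3) by (rule \<phi>.spans_image)
    show "coord.independent (\<phi> ` B)" using B(2) injB by (rule \<phi>.independent_injective_image)
  qed
  moreover have "card (\<phi> ` B) = card B"
    using injB coord.span_superset[of B] by (metis card_image inj_on_subset)
  ultimately show ?thesis using B(4) by simp
qed

text \<open>The linear map taking the standard basis to representatives of the points in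
  \<open>B\<close> is injective on its span. Taking images of lines through the origin under it
  embeds \<open>PG m\<close> in the flat and preserves dimensions.\<close>

lemma PG_flat_embedding:
  fixes B :: "(nat \<Rightarrow> 'f::field) set set"
  assumes B: "B \<subseteq> PG_points d" "finite B" "coord.dim (\<Union>B) = card B" "card B = Suc m"
  shows "\<exists>g :: (nat \<Rightarrow> 'f) set \<Rightarrow> (nat \<Rightarrow> 'f) set. inj_on g (PG_points m) \<and>
    g ` PG_points m \<subseteq> {L \<in> PG_points d. L \<subseteq> coord.span (\<Union>B)} \<and>
    (\<forall>I\<subseteq>PG_points m. coord.dim (\<Union>(g ` I)) = coord.dim (\<Union>I))"
proof -
  have "\<forall>L\<in>B. \<exists>v. v \<noteq> 0 \<and> (\<forall>i>d. v i = 0) \<and> L = coord.span {v}"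
    using B(1) by (auto simp: PG_points_iff)
  then obtain f where f: "\<And>L. L \<in> B \<Longrightarrow> f L \<noteq> 0 \<and> (\<forall>i>d. f L i = 0) \<and> L = coord.span {f L}"
    by metis
  have "inj_on f B" by (rule inj_onI) (metis f)
  then have cardf: "card (f ` B) = Suc m" using B(4) by (simp add: card_image)
  have span: "coord.span (f ` B) = coord.span (\<Union>B)"
  proof -
    have "L \<subseteq> coord.span (f ` B)" if "L \<in> B" for L
      using f[OF that] that coord.span_mono[of "{f L}" "f ` B"] by auto
    moreover have "f L \<in> L" if "L \<in> B" for L
      using f[OF that] coord.span_base[of "f L" "{f L}"] by simp
    then have "f ` B \<subseteq> coord.span (\<Union>B)"
      using coord.span_superset[of "\<Union>B"] by blast
    ultimately show ?thesis unfolding coord.span_eq by blast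
  qed
  \<comment> \<open>The \<open>m + 1\<close> representatives span the same space as the points of
    \<open>B\<close>, which has dimension \<open>m + 1\<close>.\<close>
  have ind: "coord.independent (f ` B)"
    using B cardf coord.span_eq_dim[OF span] by (intro independent_if_dim_eq_card) auto
  define U :: "(nat \<Rightarrow> 'f) set" where "U = coord_unit ` {..<Suc m}"
  have "finite U" "card U = Suc m"
    by (auto simp: U_def card_image[OF inj_on_subset[OF inj_coord_unit subset_UNIV]])
  then obtain h where h: "bij_betw h U (f ` B)"
    using cardf B(2) by (metis finite_imageI finite_same_card_bij)
  interpret vector_space_pair "coord_scale :: 'f \<Rightarrow> _" "coord_scale :: 'f \<Rightarrow> _"
    by unfold_locales
  have indU: "coord.independent U" unfolding U_def by (rule independent_coord_unit)
  then obtain \<phi> where \<phi>: "Vector_Spaces.linear coord_scale coord_scale \<phi>" "\<And>u. u \<in> U \<Longrightarrow> \<phi> u = h u"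
    using linear_independent_extend[of U h] by blast
  interpret \<phi>: Vector_Spaces.linear coord_scale coord_scale \<phi> by fact
  have img: "\<phi> ` U = f ` B" using h \<phi>(2) by (simp add: bij_betw_def)
  have "inj_on \<phi> U" using h \<phi>(2) by (simp add: bij_betw_def inj_on_def)
  then have inj: "inj_on \<phi> (coord.span U)"
    using ind img by (subst \<phi>.inj_on_span_iff_independent_image) auto
  have spanU: "coord.span U = {v. \<forall>i>m. v i = 0}"
    unfolding U_def span_coord_unit by (auto simp: Suc_le_eq)
  have sub: "L \<subseteq> coord.span U" if "L \<in> PG_points m" for L :: "(nat \<Rightarrow> 'f) set"
    using that unfolding spanU by (auto simp: PG_points_def)
  have flat: "coord.span (\<Union>B) \<subseteq> {v. \<forall>i>d. v i = 0}"
    using B(1) subspace_coord by (intro coord.span_minimal) (auto simp: PG_points_def)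
  show ?thesis
  proof (intro exI[of _ "image \<phi>"] conjI allI impI)
    show "inj_on (image \<phi>) (PG_points m)"
      using inj sub by (intro inj_onI) (meson inj_on_image_eq_iff)
    show "image \<phi> ` PG_points m \<subseteq> {L \<in> PG_points d. L \<subseteq> coord.span (\<Union>B)}"
    proof (intro image_subsetI)
      fix L :: "(nat \<Rightarrow> 'f) set" assume L: "L \<in> PG_points m"
      then obtain v where v: "v \<noteq> 0" "L = coord.span {v}" by (auto simp: PG_points_iff)
      have "\<phi> ` L \<subseteq> \<phi> ` coord.span U" using sub[OF L] by auto
      also have "\<dots> = coord.span (\<Union>B)" by (simp add: \<phi>.span_image[symmetric] img span)
      finally have le: "\<phi> ` L \<subseteq> coord.span (\<Union>B)" .
      have im: "\<phi> ` L = coord.span {\<phi> v}" using \<phi>.span_image[of "{v}"] v by simp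
      have "v \<in> coord.span U" using sub[OF L] v(2) coord.span_base[of v "{v}"] by blast
      then have "\<phi> v \<noteq> 0" using inj v(1) \<phi>.zero coord.span_zero[of U] by (metis inj_onD)
      moreover have "\<phi> v \<in> {v. \<forall>i>d. v i = 0}"
        using le flat im coord.span_base[of "\<phi> v" "{\<phi> v}"] by blast
      ultimately show "\<phi> ` L \<in> {L \<in> PG_points d. L \<subseteq> coord.span (\<Union>B)}"
        using im le by (auto simp: PG_points_iff)
    qed
    fix I :: "(nat \<Rightarrow> 'f) set set" assume "I \<subseteq> PG_points m"
    then have "\<Union>I \<subseteq> coord.span U" using sub by blast
    then have "coord.span (\<Union>I) \<subseteq> coord.span U" by (intro coord.span_minimal) auto
    then have "coord.dim (\<phi> ` \<Union>I) = coord.dim (\<Union>I)"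
      using \<phi>(1) inj by (intro coord_dim_image) (auto intro: inj_on_subset)
    then show "coord.dim (\<Union>(image \<phi> ` I)) = coord.dim (\<Union>I)" by (simp add: image_Union)
  qed
qed

lemma dim_insert_point_in_span:
  assumes "L \<subseteq> coord.span (\<Union>B)" "coord.dim (\<Union>B) = card B" "finite B" "L \<notin> B"
  shows "coord.dim (\<Union>(insert L B)) \<noteq> card (insert L B)"
proof -
  have "coord.span (\<Union>(insert L B)) = coord.span (\<Union>B)"
    using assms(1) coord.span_superset[of "\<Union>B"] coord.span_superset[of "\<Union>(insert L B)"]
    unfolding coord.span_eq by auto
  then have "coord.dim (\<Union>(insert L B)) = card B"
    using assms(2) coord.span_eq_dim by metis
  then show ?thesis using assms(3,4) by simp
qed

lemma dim_two_points:
  assumes "L1 \<in> PG_points d" "L2 \<in> PG_points d" "L1 \<noteq> L2"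
  shows "coord.dim (\<Union>{L1, L2}) = 2"
proof -
  obtain v1 v2 where v: "v1 \<noteq> 0" "L1 = coord.span {v1}" "v2 \<noteq> 0" "L2 = coord.span {v2}"
    using assms(1,2) by (auto simp: PG_points_iff)
  have "v1 \<notin> coord.span {v2}" using span_nonzero_in_line[of v1 v2] v assms(3) by auto
  then have ind: "coord.independent {v1, v2}" and ne: "v1 \<noteq> v2"
    using coord.independent_insertI[of v1 "{v2}"] v(3) coord.span_base[of v2 "{v2}"] by auto
  have "coord.span (\<Union>{L1, L2}) = coord.span {v1, v2}"
    unfolding coord.span_eq v
    using coord.span_mono[of "{v1}" "{v1, v2}"] coord.span_mono[of "{v2}" "{v1, v2}"]
      coord.span_superset[of "{v1}"] coord.span_superset[of "{v2}"]
      coord.span_superset[of "\<Union>{coord.span {v1}, coord.span {v2}}"] by auto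
  then have "coord.dim (\<Union>{L1, L2}) = coord.dim {v1, v2}" by (rule coord.span_eq_dim)
  then show ?thesis using coord.dim_eq_card_independent[OF ind] ne by simp
qed

text \<open>The representatives of points in \<open>S\<close>, together with zero, form a subspace:
  the sum of two of them represents a point on the line through the two points. This subspace
  contains the standard basis.\<close>

lemma line_closed_eq_PG_points:
  fixes S :: "(nat \<Rightarrow> 'f::field) set set"
  assumes S: "S \<subseteq> PG_points d"
    and unit: "\<And>i. i \<le> d \<Longrightarrow> coord.span {coord_unit i} \<in> S"
    and line: "\<And>L1 L2 L3. L1 \<in> S \<Longrightarrow> L2 \<in> S \<Longrightarrow> L1 \<noteq> L2 \<Longrightarrow> L3 \<in> PG_points d \<Longrightarrow>
      L3 \<noteq> L1 \<Longrightarrow> L3 \<noteq> L2 \<Longrightarrow> L3 \<subseteq> coord.span (\<Union>{L1, L2}) \<Longrightarrow> L3 \<in> S"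
  shows "S = PG_points d"
proof -
  define W where "W = {v. v = 0 \<or> coord.span {v} \<in> S}"
  have "coord.subspace W"
  proof (rule coord.subspaceI)
    show "0 \<in> W" by (simp add: W_def)
  next
    fix v w assume vw: "v \<in> W" "w \<in> W"
    show "v + w \<in> W"
    \<comment> \<open>The zero vector represents no point, and two proportional vectors span no
      line; these cases are split off before \<open>line\<close> applies.\<close>
    proof (cases "v = 0 \<or> w = 0 \<or> v + w = 0")
      case True
      then show ?thesis using vw by (auto simp: W_def)
    next
      case False
      then have pts: "coord.span {v} \<in> S" "coord.span {w} \<in> S" using vw by (auto simp: W_def)
      have v: "v \<in> coord.span {v}" and w: "w \<in> coord.span {w}"
        by (auto intro: coord.span_base)
      show ?thesis
      proof (cases "coord.span {v} = coord.span {w}")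
        case True
        then have "v + w \<in> coord.span {v}" using v w by (metis coord.span_add)
        then have "coord.span {v + w} = coord.span {v}"
          using False by (intro span_nonzero_in_line) auto
        then show ?thesis using pts by (simp add: W_def)
      next
        case ne: False
        define L where "L = coord.span {v + w}"
        have "v + w \<in> coord.span (\<Union>{coord.span {v}, coord.span {w}})"
          using v w by (intro coord.span_add) (auto intro: coord.span_base)
        then have sub: "L \<subseteq> coord.span (\<Union>{coord.span {v}, coord.span {w}})"
          unfolding L_def by (intro coord.span_minimal) auto
        have "v \<in> {v. \<forall>i>d. v i = 0}" "w \<in> {v. \<forall>i>d. v i = 0}"
          using pts S v w by (auto simp: PG_points_def)
        then have "L \<in> PG_points d" using False by (auto simp: L_def PG_points_iff)
        then have "L \<in> S" using line[OF pts ne _ _ _ sub] pts by metis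
        then show ?thesis by (simp add: W_def L_def)
      qed
    qed
  next
    fix c :: 'f and v assume v: "v \<in> W"
    have "coord_scale c v \<in> coord.span {v}" by (intro coord.span_scale coord.span_base) simp
    then show "coord_scale c v \<in> W"
      using v span_nonzero_in_line[of "coord_scale c v" v]
      by (cases "coord_scale c v = 0") (auto simp: W_def)
  qed
  moreover have "coord_unit ` {..<Suc d} \<subseteq> W" using unit by (auto simp: W_def less_Suc_eq_le)
  ultimately have "coord.span (coord_unit ` {..<Suc d}) \<subseteq> W" by (intro coord.span_minimal)
  then have W: "{v. \<forall>i\<ge>Suc d. v i = 0} \<subseteq> W" unfolding span_coord_unit .
  show ?thesis
  proof
    show "PG_points d \<subseteq> S"
    proof
      fix L :: "(nat \<Rightarrow> 'f) set" assume "L \<in> PG_points d"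
      then obtain v where v: "v \<noteq> 0" "\<forall>i>d. v i = 0" "L = coord.span {v}"
        by (auto simp: PG_points_iff)
      then have "v \<in> W" using W by auto
      then show "L \<in> S" using v by (simp add: W_def)
    qed
  qed fact
qed

text \<open>Since the flat \<open>F\<close> contains a copy of \<open>PG m\<close>, it remains to
  compare independence within \<open>F\<close> after the contraction of \<open>C\<close>.\<close>

lemma rank_minor_PG_flat:
  fixes B :: "(nat \<Rightarrow> 'f::field) set set"
  assumes B: "B \<subseteq> PG_points d" "finite B" "coord.dim (\<Union>B) = card B" "card B = Suc m"
    and F: "F = {L \<in> PG_points d. L \<subseteq> coord.span (\<Union>B)}"
    and C: "C \<subseteq> PG_points d" "F \<inter> C = {}"
    and ind: "\<And>X. X \<subseteq> F \<Longrightarrow> r (X \<union> C) - r C = int (card X) \<longleftrightarrow> coord.dim (\<Union>X) = card X"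
  shows "rank_minor (PG_points d) r (PG m :: (nat \<Rightarrow> 'f) set matroid)"
proof -
  obtain g :: "(nat \<Rightarrow> 'f) set \<Rightarrow> (nat \<Rightarrow> 'f) set"
    where g: "inj_on g (PG_points m)" "g ` PG_points m \<subseteq> F"
      and dim: "\<forall>I\<subseteq>PG_points m. coord.dim (\<Union>(g ` I)) = coord.dim (\<Union>I)"
    using PG_flat_embedding[OF B] unfolding F[symmetric] by (elim exE conjE) (rule that)
  show ?thesis
    unfolding rank_minor_def
  proof (intro exI[of _ C] exI[of _ g] conjI allI impI)
    show "C \<subseteq> PG_points d" by fact
    show "inj_on g (ground (PG m))" using g by (simp add: PG_def)
    show "g ` ground (PG m) \<subseteq> PG_points d - C" using g C F by (auto simp: PG_def)
    fix I :: "(nat \<Rightarrow> 'f) set set" assume "I \<subseteq> ground (PG m)"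
    then have I: "I \<subseteq> PG_points m" by (simp add: PG_def)
    then have "card (g ` I) = card I" using g(1) by (meson card_image inj_on_subset)
    moreover have "g ` I \<subseteq> F" using I g(2) by blast
    ultimately show "I \<in> indep (PG m) \<longleftrightarrow> r (g ` I \<union> C) - r C = int (card I)"
      using ind[of "g ` I"] dim I by (simp add: PG_def)
  qed
qed

section \<open>Rank functions of projective geometries\<close>

locale PG_rank_function = rank_function "PG_points d" r
  for d and r :: "(nat \<Rightarrow> 'f::field) set set \<Rightarrow> int" +
  assumes rank_eq_card_iff:
    "X \<subseteq> PG_points d \<Longrightarrow> r X = int (card X) \<longleftrightarrow> coord.dim (\<Union>X) = card X"
begin

text \<open>A point of the span added to \<open>B\<close> gives a dependent set, so it cannot raise
  the rank of \<open>B\<close>; \<open>rank_closure\<close> handles all such points at once.\<close>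

lemma rank_flat:
  assumes B: "B \<subseteq> PG_points d" "r B = int (card B)"
  shows "r {L \<in> PG_points d. L \<subseteq> coord.span (\<Union>B)} = r B"
proof -
  define F where "F = {L \<in> PG_points d. L \<subseteq> coord.span (\<Union>B)}"
  have finB: "finite B" using B(1) by (rule finite_subset_ground)
  have "r (B \<union> F) = r B"
  proof (rule rank_closure)
    fix L assume L: "L \<in> F"
    show "r (insert L B) = r B"
    proof (cases "L \<in> B")
      case False
      have "coord.dim (\<Union>(insert L B)) \<noteq> card (insert L B)"
        using L False B finB rank_eq_card_iff[of B]
        by (intro dim_insert_point_in_span) (auto simp: F_def)
      then have "r (insert L B) \<noteq> int (card (insert L B))"
        using rank_eq_card_iff[of "insert L B"] L B by (auto simp: F_def)
      moreover have "r (insert L B) \<le> r B + 1" "r B \<le> r (insert L B)"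
        using L B(1) by (auto simp: F_def intro: rank_insert_le rank_mono)
      ultimately show ?thesis using False finB B(2) by simp
    qed (simp add: insert_absorb)
  qed (use B in \<open>auto simp: F_def\<close>)
  moreover have "B \<union> F = F" using B(1) coord.span_superset[of "\<Union>B"] by (auto simp: F_def)
  ultimately show ?thesis by (simp add: F_def)
qed

lemma rank_coord_unit_points:
  "r ((\<lambda>i. coord.span {coord_unit i}) ` {..d}) = int (Suc d)"
  using rank_eq_card_iff[OF coord_unit_points(1)] coord_unit_points(2,3)[where d = d and 'f = 'f]
  by simp

lemma rank_ground_ge: "int (Suc d) \<le> r (PG_points d)"
  using rank_coord_unit_points coord_unit_points(1)[where d = d and 'f = 'f]
  by (metis order_refl rank_mono)

end

text \<open>A maximal set \<open>X\<close> with \<delta> = 0 spans \<open>p\<close>, so its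
  \<open>q\<close>-rank is at least \<open>d\<close>. The \<open>q\<close>-flat of
  \<open>m + 1\<close> independent points of \<open>X\<close> again has \<delta> = 0, and
  restricting \<open>p\<close> to it gives the minor.\<close>

lemma PG_quotient_rank_minor:
  fixes p q :: "(nat \<Rightarrow> 'f::field) set set \<Rightarrow> int"
  assumes "rank_quotient (PG_points d) p q" and "PG_rank_function d q" and "Suc m \<le> d"
  shows "rank_minor (PG_points d) p (PG m :: (nat \<Rightarrow> 'f) set matroid)"
proof -
  interpret rank_quotient "PG_points d" p q by fact
  interpret q: PG_rank_function d q by fact
  define \<A> where "\<A> = {X. X \<subseteq> PG_points d \<and> q X = p X}"
  have "finite \<A>" unfolding \<A>_def using p.finite_ground by simp
  moreover have "{} \<in> \<A>" using p.rank_empty q.rank_empty by (simp add: \<A>_def)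
  ultimately obtain X where "X \<in> \<A>" and max: "\<And>Y. Y \<in> \<A> \<Longrightarrow> X \<subseteq> Y \<Longrightarrow> X = Y"
    using finite_has_maximal[of \<A>] by auto
  then have X: "X \<subseteq> PG_points d" "q X = p X" by (auto simp: \<A>_def)
  \<comment> \<open>By maximality every further point makes \<delta> jump to one, so it raises
    \<open>q\<close> and leaves \<open>p\<close> unchanged.\<close>
  have "p (X \<union> PG_points d) = p X"
  proof (rule p.rank_closure)
    fix y :: "(nat \<Rightarrow> 'f) set" assume y: "y \<in> PG_points d"
    show "p (insert y X) = p X"
    proof (cases "y \<in> X")
      case False
      then have "q (insert y X) \<noteq> p (insert y X)" using max[of "insert y X"] X y by (auto simp: \<A>_def)
      moreover have "p (insert y X) \<le> q (insert y X)" using X y by (intro quotient_le) auto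
      moreover have "q (insert y X) \<le> q X + 1" using X y by (intro q.rank_insert_le) auto
      moreover have "p X \<le> p (insert y X)" using X y by (intro p.rank_mono) auto
      ultimately show ?thesis using X(2) by simp
    qed (simp add: insert_absorb)
  qed (use X in auto)
  then have "p (PG_points d) = p X" using X(1) by (simp add: Un_absorb1)
  then have "int d \<le> q X" using corank q.rank_ground_ge X(2) by simp
  then obtain B where B: "B \<subseteq> X" "q B = int (card B)" "card B = Suc m"
    using q.independent_augment[of "{}" X "Suc m"] X(1) q.rank_empty assms(3) by auto
  have BE: "B \<subseteq> PG_points d" using B(1) X(1) by blast
  define F where "F = {L \<in> PG_points d. L \<subseteq> coord.span (\<Union>B)}"
  have FE: "F \<subseteq> PG_points d" by (auto simp: F_def)
  have BF: "B \<subseteq> F" using BE coord.span_superset[of "\<Union>B"] by (auto simp: F_def)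
  \<comment> \<open>The chain \<open>q F = q B = p B \<le> p F \<le> q F\<close> collapses to
    equalities.\<close>
  have "q F = q B" unfolding F_def using BE B(2) by (rule q.rank_flat)
  moreover have "q B = p B" using X B(1) by (rule quotient_eq_subset)
  moreover have "p B \<le> p F" using BF FE by (rule p.rank_mono)
  moreover have "p F \<le> q F" using FE by (rule quotient_le)
  ultimately have F: "q F = p F" by simp
  show ?thesis
  proof (rule rank_minor_PG_flat[OF BE _ _ B(3) F_def])
    show "finite B" using BE by (rule p.finite_subset_ground)
    show "coord.dim (\<Union>B) = card B" using q.rank_eq_card_iff[OF BE] B(2) by simp
    fix Y assume Y: "Y \<subseteq> F"
    then have "q Y = p Y" using quotient_eq_subset[OF FE F] by blast
    then show "p (Y \<union> {}) - p {} = int (card Y) \<longleftrightarrow> coord.dim (\<Union>Y) = card Y"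
      using q.rank_eq_card_iff[of Y] Y FE p.rank_empty by auto
  qed auto
qed

text \<open>Contracting a collinear triple with \<delta> = 1 costs rank two in \<open>p\<close>,
  which accounts for \<open>d = m + 2\<close>.\<close>

lemma PG_lift_rank_minor:
  fixes p q :: "(nat \<Rightarrow> 'f::field) set set \<Rightarrow> int"
  assumes "rank_quotient (PG_points d) p q" and "PG_rank_function d p" and d: "d = m + 2"
  shows "rank_minor (PG_points d) q (PG m :: (nat \<Rightarrow> 'f) set matroid)"
proof -
  interpret rank_quotient "PG_points d" p q by fact
  interpret p: PG_rank_function d p by fact
  have two: "p {L1, L2} = 2"
    if "L1 \<in> PG_points d" "L2 \<in> PG_points d" "L1 \<noteq> L2" for L1 L2 :: "(nat \<Rightarrow> 'f) set"
    using dim_two_points[OF that] p.rank_eq_card_iff[of "{L1, L2}"] that by simp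
  have line: "p {L1, L2, L3} = 2"
    if "L1 \<in> PG_points d" "L2 \<in> PG_points d" "L1 \<noteq> L2" "L3 \<in> PG_points d"
      "L3 \<subseteq> coord.span (\<Union>{L1, L2})" for L1 L2 L3 :: "(nat \<Rightarrow> 'f) set"
  proof -
    have "p {L1, L2} \<le> p {L1, L2, L3}" using that by (intro p.rank_mono) auto
    moreover have "p {L1, L2, L3} \<le> p {L \<in> PG_points d. L \<subseteq> coord.span (\<Union>{L1, L2})}"
      using that coord.span_superset[of "\<Union>{L1, L2}"] by (intro p.rank_mono) auto
    moreover have "\<dots> = p {L1, L2}" using that two by (intro p.rank_flat) auto
    ultimately show ?thesis using two that by simp
  qed
  show ?thesis
  proof (cases "\<exists>L1 L2 L3. L1 \<in> PG_points d \<and> L2 \<in> PG_points d \<and> L1 \<noteq> L2 \<and> L3 \<in> PG_points d \<and>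
      L3 \<subseteq> coord.span (\<Union>{L1, L2}) \<and> q {L1, L2, L3} \<noteq> p {L1, L2, L3}")
    case True
    then obtain L1 L2 L3 where L: "L1 \<in> PG_points d" "L2 \<in> PG_points d" "L1 \<noteq> L2" "L3 \<in> PG_points d"
      "L3 \<subseteq> coord.span (\<Union>{L1, L2})" "q {L1, L2, L3} \<noteq> p {L1, L2, L3}" by blast
    define A where "A = {L1, L2, L3}"
    have A: "A \<subseteq> PG_points d" "p A = 2" using L line[OF L(1-5)] by (auto simp: A_def)
    have qA: "q A = 3"
      using quotient_le[OF A(1)] quotient_ge[OF A(1)] A(2) L(6) by (simp add: A_def)
    \<comment> \<open>The first two points of the triple are completed to a basis of size
      \<open>d + 1 = m + 3\<close>; the remaining \<open>m + 1\<close> points span a flat skew to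
      the line.\<close>
    have "\<exists>J. {L1, L2} \<subseteq> J \<and> J \<subseteq> PG_points d \<and> p J = int (card J) \<and> card J = m + 3"
    proof (rule p.independent_augment)
      show "p {L1, L2} = int (card {L1, L2})" using two[OF L(1-3)] L(3) by simp
      show "card {L1, L2} \<le> m + 3" using L(3) by simp
      show "int (m + 3) \<le> p (PG_points d)" using p.rank_ground_ge d by simp
    qed (use L in auto)
    then obtain J where J: "{L1, L2} \<subseteq> J" "J \<subseteq> PG_points d" "p J = int (card J)" "card J = m + 3"
      by blast
    define B where "B = J - {L1, L2}"
    have finJ: "finite J" using J(2) by (rule p.finite_subset_ground)
    have B: "B \<subseteq> PG_points d" "p B = int (card B)" "card B = Suc m" "finite B"
      using J L(3) finJ p.independent_subset[of J B] by (auto simp: B_def card_Diff_subset)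
    define F where "F = {L \<in> PG_points d. L \<subseteq> coord.span (\<Union>B)}"
    have FE: "F \<subseteq> PG_points d" by (auto simp: F_def)
    have BF: "B \<subseteq> F" using B(1) coord.span_superset[of "\<Union>B"] by (auto simp: F_def)
    have pF: "p F = int (Suc m)" using p.rank_flat[OF B(1,2)] B(2,3) by (simp add: F_def)
    have "p J \<le> p (F \<union> A)"
      using BF FE A by (intro p.rank_mono) (auto simp: B_def A_def)
    then have pFA: "int (m + 3) \<le> p (F \<union> A)" using J by simp
    have skew: "p (X \<union> A) = p X + 2" if "X \<subseteq> F" for X
    proof -
      have "p (F \<union> A) - p F \<le> p (X \<union> A) - p X"
        using that FE A(1) by (intro p.rank_diminishing) auto
      moreover have "p (X \<union> A) \<le> p X + p A"
        using that FE A(1) by (intro p.rank_union_le) auto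
      ultimately show ?thesis using pF pFA A(2) by simp
    qed
    \<comment> \<open>The lower bound is the quotient inequality. The upper bound holds because
      \<delta> has already reached its maximum one on \<open>A\<close>.\<close>
    have qp: "q (X \<union> A) - q A = p X" if "X \<subseteq> F" for X
    proof -
      have XA: "X \<union> A \<subseteq> PG_points d" using that FE A by auto
      then have "p (X \<union> A) - p A \<le> q (X \<union> A) - q A" by (intro quotient) auto
      then show ?thesis
        using quotient_ge[OF XA] skew[OF that] A(2) qA by simp
    qed
    show ?thesis
    proof (rule rank_minor_PG_flat[OF B(1,4) _ B(3) F_def A(1)])
      show "coord.dim (\<Union>B) = card B" using p.rank_eq_card_iff[OF B(1)] B(2) by simp
      show "F \<inter> A = {}"
      proof (rule ccontr)
        assume "F \<inter> A \<noteq> {}"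
        then obtain L where "L \<in> F" "L \<in> A" by blast
        \<comment> \<open>For a point of \<open>A\<close> the union with \<open>A\<close> is
          \<open>A\<close> itself, so skewness leaves no rank for the point.\<close>
        then have "p {L} = 0" using skew[of "{L}"] A(2) by (simp add: insert_absorb)
        moreover have "p {L} = 1"
          using p.rank_eq_card_iff[of "{L}"] \<open>L \<in> F\<close> by (auto simp: F_def PG_points_def)
        ultimately show False by simp
      qed
      fix X assume X: "X \<subseteq> F"
      then show "q (X \<union> A) - q A = int (card X) \<longleftrightarrow> coord.dim (\<Union>X) = card X"
        using qp[OF X] p.rank_eq_card_iff[of X] FE by auto
    qed
  next
    case False
    define U where "U = (\<lambda>i. coord.span {coord_unit i :: nat \<Rightarrow> 'f}) ` {..d}"
    have U: "U \<subseteq> PG_points d" "card U = Suc d" "p U = int (Suc d)"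
      using coord_unit_points[where d = d and 'f = 'f] p.rank_coord_unit_points
      by (auto simp: U_def)
    have qU: "q U = int (Suc d)" using quotient_le[OF U(1)] q.rank_le_card[OF U(1)] U by simp
    \<comment> \<open>This is the \<open>q\<close>-closure of the frame; once it is everything,
      \<open>q\<close> has the rank of \<open>p\<close> and \<delta> vanishes throughout.\<close>
    define S where "S = {L \<in> PG_points d. q (insert L U) = q U}"
    have "S = PG_points d"
    proof (rule line_closed_eq_PG_points)
      show "S \<subseteq> PG_points d" by (auto simp: S_def)
      show "coord.span {coord_unit i} \<in> S" if "i \<le> d" for i
      proof -
        have "coord.span {coord_unit i} \<in> U" using that by (auto simp: U_def)
        then show ?thesis using U(1) by (auto simp: S_def insert_absorb)
      qed
      fix L1 L2 L3
      assume L: "L1 \<in> S" "L2 \<in> S" "L1 \<noteq> L2" "L3 \<in> PG_points d" "L3 \<noteq> L1" "L3 \<noteq> L2"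
        "L3 \<subseteq> coord.span (\<Union>{L1, L2})"
      then have pts: "L1 \<in> PG_points d" "L2 \<in> PG_points d" by (auto simp: S_def)
      have "q {L1, L2, L3} = p {L1, L2, L3}" using False pts L by blast
      also have "\<dots> = 2" using line pts L by blast
      finally have q3: "q {L1, L2, L3} = 2" .
      have q2: "2 \<le> q {L1, L2}"
        using two[OF pts L(3)] quotient_le[of "{L1, L2}"] pts by simp
      have "q (U \<union> {L1, L2}) = q U"
        using U(1) pts L by (intro q.rank_closure) (auto simp: S_def)
      \<comment> \<open>The third point of the line adds nothing over the first two in
        \<open>q\<close>, hence nothing over a larger set.\<close>
      moreover have "q ((U \<union> {L1, L2}) \<union> {L3}) - q (U \<union> {L1, L2})
          \<le> q ({L1, L2} \<union> {L3}) - q {L1, L2}"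
        using U(1) pts L(4) by (intro q.rank_diminishing) auto
      moreover have "{L1, L2} \<union> {L3} = {L1, L2, L3}" by auto
      moreover have "q (insert L3 U) \<le> q ((U \<union> {L1, L2}) \<union> {L3})"
        using U(1) pts L(4) by (intro q.rank_mono) auto
      moreover have "q U \<le> q (insert L3 U)"
        using U(1) L(4) by (intro q.rank_mono) auto
      ultimately show "L3 \<in> S" using q2 q3 L(4) by (simp add: S_def)
    qed
    then have "q (U \<union> PG_points d) = q U"
      using U(1) by (intro q.rank_closure) (auto simp: S_def)
    then have "q (PG_points d) = p U" using U qU by (simp add: Un_absorb1)
    moreover have "p U \<le> p (PG_points d)" using U(1) by (intro p.rank_mono) auto
    ultimately have "q (PG_points d) = p (PG_points d)"
      using quotient_le[of "PG_points d"] by simp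
    then have qp: "q X = p X" if "X \<subseteq> PG_points d" for X
      using quotient_eq_subset[of "PG_points d" X] that by simp
    have "Suc m \<le> card U" using U(2) d by simp
    then obtain B where B: "B \<subseteq> U" "card B = Suc m" by (rule obtain_subset_with_card_n)
    have BE: "B \<subseteq> PG_points d" using B(1) U(1) by blast
    have pB: "p B = int (card B)" using p.independent_subset[OF _ B(1) U(1)] U(2,3) by simp
    show ?thesis
    proof (rule rank_minor_PG_flat[OF BE _ _ B(2) refl])
      show "finite B" using BE by (rule p.finite_subset_ground)
      show "coord.dim (\<Union>B) = card B" using p.rank_eq_card_iff[OF BE] pB by simp
      fix X assume "X \<subseteq> {L \<in> PG_points d. L \<subseteq> coord.span (\<Union>B)}"
      then have "X \<subseteq> PG_points d" by blast
      then show "q (X \<union> {}) - q {} = int (card X) \<longleftrightarrow> coord.dim (\<Union>X) = card X"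
        using qp p.rank_eq_card_iff[of X] q.rank_empty by simp
    qed auto
  qed
qed

section \<open>Minors of elementary lifts and projections\<close>

lemma PG_rank_function_minor:
  assumes "rank_function (PG_points d) r"
    and "\<And>I. I \<subseteq> PG_points d \<Longrightarrow> I \<in> indep (PG d) \<longleftrightarrow> r I = int (card I)"
  shows "PG_rank_function d r"
  using assms unfolding PG_rank_function_def PG_rank_function_axioms_def by (simp add: PG_def)

text \<open>The pair \<open>p\<close>, \<open>q\<close> is pulled back to the ground set of
  \<open>L\<close>, where one member has the independent sets of \<open>L\<close>: \<open>q\<close>
  for a projection and \<open>p\<close> for a lift. A minor \<open>L'\<close> of the other member is
  then a minor of \<open>N\<close>.\<close>

lemma elementary_has_minor:
  assumes ground: "ground M = ground N" and elem: "elementary_lift M N \<or> elementary_projection M N"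
    and has: "has_minor M L"
    and proj: "\<And>p q. rank_quotient (ground L) p q \<Longrightarrow>
      (\<And>I. I \<subseteq> ground L \<Longrightarrow> I \<in> indep L \<longleftrightarrow> q I = int (card I)) \<Longrightarrow> rank_minor (ground L) p L'"
    and lift: "\<And>p q. rank_quotient (ground L) p q \<Longrightarrow>
      (\<And>I. I \<subseteq> ground L \<Longrightarrow> I \<in> indep L \<longleftrightarrow> p I = int (card I)) \<Longrightarrow> rank_minor (ground L) q L'"
  shows "has_minor N L'"
proof -
  obtain p q where quot: "rank_quotient (ground M) p q"
    and ranks: "(\<forall>X\<subseteq>ground M. int (matroid_rank M X) = q X \<and> int (matroid_rank N X) = p X) \<or>
      (\<forall>X\<subseteq>ground M. int (matroid_rank M X) = p X \<and> int (matroid_rank N X) = q X)"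
    using elem
  proof
    assume "elementary_lift M N"
    then obtain K where "is_matroid K" "None \<in> ground K"
      "contract K {None} = map_matroid Some M" "delete K {None} = map_matroid Some N"
      unfolding elementary_lift_def coextension_def by blast
    then show thesis using quotient_of_extension[of K N M] ground that by metis
  next
    assume "elementary_projection M N"
    then obtain K where "is_matroid K" "None \<in> ground K"
      "delete K {None} = map_matroid Some M" "contract K {None} = map_matroid Some N"
      unfolding elementary_projection_def extension_def by blast
    then show thesis using quotient_of_extension[of K M N] that by metis
  qed
  interpret rank_quotient "ground M" p q by fact
  \<comment> \<open>Naming the two ranks by their matroids lets both cases share the passage to the
    minor and back.\<close>
  obtain rM rN where rM: "\<And>X. X \<subseteq> ground M \<Longrightarrow> int (matroid_rank M X) = rM X"
    and rN: "\<And>X. X \<subseteq> ground N \<Longrightarrow> int (matroid_rank N X) = rN X"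
    and or: "rM = q \<and> rN = p \<or> rM = p \<and> rN = q"
    using ranks ground by metis
  have "rank_minor (ground M) rM L"
    using has has_minor_iff_rank_minor[of M rM L] rM by simp
  then obtain C g where C: "C \<subseteq> ground M"
    and g: "inj_on g (ground L)" "g ` ground L \<subseteq> ground M - C"
    and ind: "\<forall>I. I \<subseteq> ground L \<longrightarrow> (I \<in> indep L \<longleftrightarrow> rM (g ` I \<union> C) - rM C = int (card I))"
    unfolding rank_minor_def by (elim exE conjE) (rule that)
  have "finite (ground L)"
    using g p.finite_ground by (meson finite_Diff inj_on_finite)
  then have quot': "rank_quotient (ground L) (\<lambda>X. p (g ` X \<union> C) - p C) (\<lambda>X. q (g ` X \<union> C) - q C)"
    using C g by (intro minor_rank_quotient) auto
  have "rank_minor (ground L) (\<lambda>X. rN (g ` X \<union> C) - rN C) L'"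
    using or
  proof
    assume "rM = q \<and> rN = p"
    then show ?thesis using proj[OF quot'] ind by simp
  next
    assume "rM = p \<and> rN = q"
    then show ?thesis using lift[OF quot'] ind by simp
  qed
  then have "rank_minor (ground N) rN L'"
    using C g ground by (intro rank_minor_trans[of C _ g "ground L"]) auto
  then show ?thesis using has_minor_iff_rank_minor[of N rN L'] rN by simp
qed

theorem theorem5p3:
  fixes M N :: "'a matroid"
  assumes "is_matroid M" and "is_matroid N" and "ground M = ground N"
    and "elementary_lift M N \<or> elementary_projection M N"
    and "N \<noteq> M"
  shows "(\<forall>s\<ge>2. has_minor M (uniform (s * 2 ^ (4 * s)) (2 * s * 2 ^ (4 * s)))
              \<longrightarrow> has_minor N (uniform s (2 * s)))
       \<and> (\<forall>n q. n \<ge> 3 \<and> primepow q \<and> q = card (UNIV :: 'f::{field,finite} set)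
              \<and> has_minor M (PG (n - 1) :: (nat \<Rightarrow> 'f) set matroid)
              \<longrightarrow> has_minor N (PG (n - 3) :: (nat \<Rightarrow> 'f) set matroid))"
proof -
  note minor = elementary_has_minor[OF assms(3,4)]
  show ?thesis
  proof (intro conjI allI impI)
    fix s :: nat
    assume s: "2 \<le> s"
      and has: "has_minor M (uniform (s * 2 ^ (4 * s)) (2 * s * 2 ^ (4 * s)))"
    define a where "a = s * 2 ^ (4 * s)"
    \<comment> \<open>This estimate serves both directions on \<open>2 * a\<close> elements: the
      projection needs \<open>a\<close> on top of the greedy bound, the lift needs the greedy bound
      below \<open>a\<close>.\<close>
    have "s - 1 + 2 ^ (3 * s - 1) \<le> (s - 1) * 2 ^ (4 * s) + 2 ^ (4 * s)"
      by (intro add_mono power_increasing) auto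
    also have "\<dots> = a" using s by (simp add: a_def algebra_simps)
    finally have large: "s - 1 + 2 ^ (3 * s - 1) \<le> a" .
    have "s * 2 ^ 1 \<le> a" unfolding a_def using s by (intro mult_left_mono power_increasing) auto
    then have two: "2 * s \<le> a" by simp
    have eq: "ground (uniform a (2 * a)) = {..<2 * a}" by (simp add: uniform_def)
    have unif: "r X = int (min (card X) a)"
      if "rank_function {..<2 * a} r" "X \<subseteq> {..<2 * a}"
        "\<And>I. I \<subseteq> {..<2 * a} \<Longrightarrow> I \<in> indep (uniform a (2 * a)) \<longleftrightarrow> r I = int (card I)" for r X
      using that by (intro rank_function.uniform_rank_eq[OF that(1)]) (auto simp: uniform_def)
    show "has_minor N (uniform s (2 * s))"
    proof (rule minor)
      show "has_minor M (uniform a (2 * a))" using has by (simp add: a_def mult.assoc)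
      fix p q
      assume quot: "rank_quotient (ground (uniform a (2 * a))) p q"
      then have pq: "rank_function {..<2 * a} p" "rank_function {..<2 * a} q"
        unfolding eq rank_quotient_def by blast+
      show "rank_minor (ground (uniform a (2 * a))) p (uniform s (2 * s))"
        if "\<And>I. I \<subseteq> ground (uniform a (2 * a)) \<Longrightarrow>
          I \<in> indep (uniform a (2 * a)) \<longleftrightarrow> q I = int (card I)"
        using quot unif[OF pq(2)] that s two large unfolding eq
        by (intro uniform_quotient_rank_minor[of _ p q a]) auto
      show "rank_minor (ground (uniform a (2 * a))) q (uniform s (2 * s))"
        if "\<And>I. I \<subseteq> ground (uniform a (2 * a)) \<Longrightarrow>
          I \<in> indep (uniform a (2 * a)) \<longleftrightarrow> p I = int (card I)"
        using quot unif[OF pq(1)] that s two large unfolding eq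
        by (intro uniform_lift_rank_minor[of _ p q a]) auto
    qed
  next
    fix n q' :: nat
    assume "n \<ge> 3 \<and> primepow q' \<and> q' = card (UNIV :: 'f set)
      \<and> has_minor M (PG (n - 1) :: (nat \<Rightarrow> 'f) set matroid)"
    then have n: "n \<ge> 3" and has: "has_minor M (PG (n - 1) :: (nat \<Rightarrow> 'f) set matroid)" by auto
    have eq: "ground (PG (n - 1) :: (nat \<Rightarrow> 'f) set matroid) = PG_points (n - 1)"
      by (simp add: PG_def)
    show "has_minor N (PG (n - 3) :: (nat \<Rightarrow> 'f) set matroid)"
    \<comment> \<open>Here \<open>d = n - 1\<close> and \<open>m = n - 3\<close>; since
      \<open>n \<ge> 3\<close>, the truncated subtraction is exact and
      \<open>d = m + 2\<close>.\<close>
    proof (rule minor[OF has])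
      fix p q
      assume quot: "rank_quotient (ground (PG (n - 1) :: (nat \<Rightarrow> 'f) set matroid)) p q"
      then have pq: "rank_function (PG_points (n - 1)) p" "rank_function (PG_points (n - 1)) q"
        unfolding eq rank_quotient_def by blast+
      show "rank_minor (ground (PG (n - 1))) p (PG (n - 3) :: (nat \<Rightarrow> 'f) set matroid)"
        if "\<And>I. I \<subseteq> ground (PG (n - 1)) \<Longrightarrow> I \<in> indep (PG (n - 1)) \<longleftrightarrow> q I = int (card I)"
        using quot PG_rank_function_minor[OF pq(2)] that n unfolding eq
        by (intro PG_quotient_rank_minor) auto
      show "rank_minor (ground (PG (n - 1))) q (PG (n - 3) :: (nat \<Rightarrow> 'f) set matroid)"
        if "\<And>I. I \<subseteq> ground (PG (n - 1)) \<Longrightarrow> I \<in> indep (PG (n - 1)) \<longleftrightarrow> p I = int (card I)"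
        using quot PG_rank_function_minor[OF pq(1)] that n unfolding eq
        by (intro PG_lift_rank_minor) auto
    qed
  qed
qed

end
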